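(* Let $\bar A$ be the set of primes $p$ with $p\equiv 2 \pmod 3$ for which there exist $\alpha,\beta,\gamma,\mu,\nu\in\mathbb{N}=\{1,2,\dots\}$ and primes $q,r$ with $\gcd(6,qr)=1$ such that $p+1=2^\alpha 3^\beta q^\mu$ and $p-1=2^\gamma r^\nu$. For $x\in\mathbb{R}$ let $\bar A_{\le x}=\{p\in\bar A: p\le x\}$, and let $$\mathfrak{S}_A=9\prod_{p\ge 5\text{ prime}}\Bigl(1-\frac3p\Bigr)\Bigl(1-\frac1p\Bigr)^{-3}.$$ Assume the Generalized Hardy--Littlewood Conjecture stated in the context. Then $$|\bar A_{\le x}|\sim \frac{\mathfrak{S}_A}{2}\,\frac{x}{(\log x)^3}\qquad (x\to\infty).$$
   Context: $\log$ is the natural logarithm; $f(x)\sim g(x)$ means $f(x)/g(x)\to 1$. Singular series: for $R\in\mathbb{N}$ and integers $a_i,b_i$ ($1\le i\le R$) with $\gcd(a_i,b_i)=1$, set $\mathfrak{S}=\prod_{p\text{ prime}}(1-\rho(p)/p)(1-1/p)^{-R}$, where $\rho(p)$ is the number of $n\in\mathbb{Z}/p\mathbb{Z}$ with $\prod_{i=1}^R(a_in+b_i)\equiv 0 \pmod p$. Generalized Hardy--Littlewood Conjecture: fix $R\in\mathbb{N}$ and $C>0$; for integers $a_i,b_i$ with $\gcd(a_i,b_i)=1$, $a_i>0$ ($1\le i\le R$) such that the product defining $\mathfrak{S}$ converges, one has $$\#\{n\le x:\ a_in+b_i \text{ is prime for all } i\}=(1+o_{R,C}(1))\,\mathfrak{S}\,\frac{x}{(\log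 x)^R}+o_{R,C}\Bigl(\frac{x}{(\log x)^R}\Bigr)$$ for all $x$ with $(\log x)^C\ge |a_i|,|b_i|$ for all $i$, where the implied decay in the $o$-terms depends only on $R$ and $C$ (not on the $a_i,b_i$). *)

theory Defs
  imports "HOL-Analysis.Analysis" "HOL-Number_Theory.Number_Theory"
    "HOL-Library.Landau_Symbols"
begin

definition root_count :: "nat \<Rightarrow> (nat \<Rightarrow> int) \<Rightarrow> (nat \<Rightarrow> int) \<Rightarrow> nat \<Rightarrow> nat" where
  "root_count R a b p =
     card {n \<in> {0..<int p}. [(\<Prod>i=1..R. a i * n + b i) = 0] (mod int p)}"

text \<open>
  Products over the primes are rendered as library infinite products over all naturals,
  in increasing order, with factor 1 at the non-primes.  In the sense of
  \<^const>\<open>convergent_prod\<close>, finitely many factors may vanish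
  (the value is then 0), and the remaining product must have a nonzero limit.
\<close>

definition singular_factor :: "nat \<Rightarrow> (nat \<Rightarrow> int) \<Rightarrow> (nat \<Rightarrow> int) \<Rightarrow> nat \<Rightarrow> real" where
  "singular_factor R a b p =
     (if prime p
      then (1 - real (root_count R a b p) / real p) * inverse ((1 - 1 / real p) ^ R)
      else 1)"

definition singular_series :: "nat \<Rightarrow> (nat \<Rightarrow> int) \<Rightarrow> (nat \<Rightarrow> int) \<Rightarrow> real" where
  "singular_series R a b = (\<Prod>p. singular_factor R a b p)"

definition prime_tuple_count ::
    "nat \<Rightarrow> (nat \<Rightarrow> int) \<Rightarrow> (nat \<Rightarrow> int) \<Rightarrow> real \<Rightarrow> nat" where
  "prime_tuple_count R a b x =
     card {n::nat. 1 \<le> n \<and> real n \<le> x \<and> (\<forall>i\<in>{1..R}. prime (a i * int n + b i))}"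

text \<open>
  The uniform error terms: \<open>E1\<close> and \<open>E2\<close> are chosen after \<open>R\<close> and \<open>C\<close> but before the
  linear forms, whereas the actual errors \<open>d1\<close> and \<open>d2\<close> may depend on everything.
  The condition \<open>1 < x\<close> only makes sense of the real power of \<open>ln x\<close>.
\<close>

definition generalized_Hardy_Littlewood :: bool where
  "generalized_Hardy_Littlewood \<longleftrightarrow>
     (\<forall>(R::nat) (C::real). 1 \<le> R \<longrightarrow> 0 < C \<longrightarrow>
       (\<exists>E1 E2 :: real \<Rightarrow> real.
          (E1 \<longlongrightarrow> 0) at_top \<and> (E2 \<longlongrightarrow> 0) at_top \<and>
          (\<forall>(a :: nat \<Rightarrow> int) (b :: nat \<Rightarrow> int).
             (\<forall>i\<in>{1..R}. gcd (a i) (b i) = 1 \<and> 0 < a i) \<longrightarrow>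
             convergent_prod (singular_factor R a b) \<longrightarrow>
             (\<forall>x::real. 1 < x \<longrightarrow>
                (\<forall>i\<in>{1..R}. real_of_int \<bar>a i\<bar> \<le> ln x powr C
                          \<and> real_of_int \<bar>b i\<bar> \<le> ln x powr C) \<longrightarrow>
                (\<exists>d1 d2 :: real. \<bar>d1\<bar> \<le> E1 x \<and> \<bar>d2\<bar> \<le> E2 x \<and>
                   real (prime_tuple_count R a b x) =
                     (1 + d1) * singular_series R a b * (x / ln x ^ R)
                       + d2 * (x / ln x ^ R))))))"

definition A_bar :: "nat set" where
  "A_bar = {p. prime p \<and> [p = 2] (mod 3) \<and>
     (\<exists>\<alpha> \<beta> \<gamma> \<mu> \<nu> q r :: nat.
        1 \<le> \<alpha> \<and> 1 \<le> \<beta> \<and> 1 \<le> \<gamma> \<and> 1 \<le> \<mu> \<and> 1 \<le> \<nu> \<and>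
        prime q \<and> prime r \<and> gcd 6 (q * r) = 1 \<and>
        p + 1 = 2 ^ \<alpha> * 3 ^ \<beta> * q ^ \<mu> \<and>
        p - 1 = 2 ^ \<gamma> * r ^ \<nu>)}"

definition A_bar_upto :: "real \<Rightarrow> nat set" where
  "A_bar_upto x = {p \<in> A_bar. real p \<le> x}"

definition singular_series_A :: real where
  "singular_series_A =
     9 * (\<Prod>p::nat. if prime p \<and> 5 \<le> p
                   then (1 - 3 / real p) * inverse ((1 - 1 / real p) ^ 3)
                   else 1)"

end

theory Submission
  imports Defs "HOL-Real_Asymp.Real_Asymp"
begin

text \<open>
  Since \<open>p - 1\<close> and \<open>p + 1\<close> are consecutive even numbers, exactly one of \<open>\<alpha>\<close>, \<open>\<gamma>\<close> equals \<open>1\<close>.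
  Fix \<open>\<alpha>, \<beta>, \<gamma>\<close> and put \<open>A = 2^(\<alpha>-1) 3^\<beta>\<close>, \<open>B = 2^(\<gamma>-1)\<close>.  The primes with \<open>\<mu> = \<nu> = 1\<close> come
  from the solutions of \<open>A q - B r = 1\<close>, that is \<open>q = B n + c\<close>, \<open>r = A n + d\<close>,
  \<open>p = 2 A B n + 2 A c - 1\<close>.  This triple of linear forms has one root modulo 2 and modulo 3 and
  three roots modulo every other prime, so its singular series is always the same number \<open>S\<close>, and the
  conjecture predicts \<open>S / (2 A B) * x / (ln x)^3\<close> primes up to \<open>x\<close>.  The sum of
  \<open>1 / (2 A B)\<close> over all classes is \<open>1/2\<close>.

  The limit may be taken termwise because the normalised counts are \<open>O((2 A B)^(-1/2))\<close> uniformly: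
  for \<open>2 A B \<le> (ln x)^6\<close> by the uniformity of the conjecture, and otherwise by the trivial bound
  \<open>x / (2 A B)\<close>.  The primes with \<open>\<mu> \<ge> 2\<close>, \<open>\<nu> \<ge> 2\<close> or \<open>n = 0\<close> number \<open>O(sqrt x (ln x)^3)\<close>.
\<close>

section \<open>The triple of linear forms and its singular series\<close>

text \<open>With \<open>t = 1/p\<close>, the numerator of the factor minus 1 is
  \<open>(1 - 3*t) - (1 - t)^3 = - t^2 * (3 - t)\<close>, so each factor is 1 +
  O(\<open>1/p^2\<close>) and the product converges absolutely. From \<open>p >= 5\<close> on,
  \<open>(1 - t)^3 >= 64/125 > 1/2\<close>, which gives the constant 6.\<close>

lemma convergent_prod_A_factor:
  "convergent_prod (\<lambda>p::nat. if prime p \<and> 5 \<le> p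
     then (1 - 3 / real p) * inverse ((1 - 1 / real p) ^ 3) else 1)" (is "convergent_prod ?F")
proof -
  have bound: "\<bar>?F p - 1\<bar> \<le> 6 / real p ^ 2" for p
  proof (cases "prime p \<and> 5 \<le> p")
    case True
    define t where "t = 1 / real p"
    have t: "0 < t" "t \<le> 1/5" using True by (auto simp: t_def field_simps)
    have "(4/5) ^ 3 \<le> (1 - t) ^ 3" using t by (intro power_mono) auto
    then have cube: "1/2 \<le> (1 - t) ^ 3" by (simp add: power_numeral_reduce)
    have "?F p = (1 - 3*t) / (1 - t)^3"
      using True by (simp add: t_def divide_inverse)
    then have "?F p - 1 = ((1 - 3*t) - (1 - t)^3) / (1 - t)^3"
      using t by (simp add: diff_divide_distrib)
    also have "(1 - 3*t) - (1 - t)^3 = - (t^2 * (3 - t))"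
      by (simp add: power_numeral_reduce algebra_simps)
    finally have "\<bar>?F p - 1\<bar> = t^2 * (3 - t) / (1 - t)^3"
      using t cube by (simp only: abs_divide abs_minus_cancel abs_mult) simp
    also have "\<dots> \<le> (t^2 * 3) / (1/2)"
      using t cube by (intro frac_le mult_mono) auto
    finally show ?thesis by (simp add: t_def power_divide)
  qed auto
  have "summable (\<lambda>p. 6 * inverse (real p ^ 2))"
    by (intro summable_mult inverse_power_summable) auto
  then have "summable (\<lambda>p. norm (?F p - 1))"
    by (rule summable_comparison_test') (use bound in \<open>simp add: divide_inverse\<close>)
  then show ?thesis
    by (intro abs_convergent_prod_imp_convergent_prod summable_imp_abs_convergent_prod)
qed

text \<open>A convergent product without vanishing factors is nonzero. This permits the division by
  the constant that ends the proof of the asymptotic equivalence.\<close>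

lemma singular_series_A_nonzero: "singular_series_A \<noteq> 0"
proof -
  have "1 - 3 / real p \<noteq> 0" "1 - 1 / real p \<noteq> 0" if "5 \<le> p" for p
    using that by (auto simp: field_simps)
  then show ?thesis
    unfolding singular_series_A_def
    using prodinf_nonzero[OF convergent_prod_A_factor] by (simp split: if_splits)
qed

text \<open>The root is \<open>- v\<close> times the inverse of \<open>u\<close> modulo
  \<open>l\<close>. The form with an equivalence lets root sets be rewritten as explicit finite
  sets.\<close>

lemma linear_root_unique:
  fixes u v l :: int
  assumes l: "prime l" and u: "\<not> l dvd u"
  obtains n where "n \<in> {0..<l}" "\<And>m. m \<in> {0..<l} \<Longrightarrow> l dvd u * m + v \<longleftrightarrow> m = n"
proof -
  have co: "coprime u l"
    using l u by (metis coprime_commute prime_imp_coprime)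
  then obtain w where w: "[u * w = 1] (mod l)"
    using cong_solve_coprime_int by blast
  have l0: "0 < l" using l prime_gt_0_int by blast
  define n where "n = (- v * w) mod l"
  have "[u * n = u * (- v * w)] (mod l)"
    unfolding n_def by (intro cong_scalar_left) (simp add: cong_def)
  also have "u * (- v * w) = - v * (u * w)" by simp
  also have "[- v * (u * w) = - v * 1] (mod l)"
    using w by (rule cong_scalar_left)
  finally have n: "[u * n = - v] (mod l)" by simp
  show thesis
  proof
    show nl: "n \<in> {0..<l}" using l0 by (simp add: n_def)
    fix m assume m: "m \<in> {0..<l}"
    have "l dvd u * m + v \<longleftrightarrow> [u * m = - v] (mod l)"
      by (simp add: cong_iff_dvd_diff)
    also have "\<dots> \<longleftrightarrow> [u * m = u * n] (mod l)"
      using n by (metis cong_sym cong_trans)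
    also have "\<dots> \<longleftrightarrow> [m = n] (mod l)"
      using co by (rule cong_mult_lcancel)
    also have "\<dots> \<longleftrightarrow> m = n"
      using m nl by (auto intro: cong_less_imp_eq_int)
    finally show "l dvd u * m + v \<longleftrightarrow> m = n" .
  qed
qed

text \<open>Here \<open>(c, d)\<close> is the particular solution of
  \<open>A * q - B * r = 1\<close> whose first entry is reduced modulo \<open>B\<close>; this makes
  the constant terms as small as the slopes. The last assumption says that 2 and 3 are exactly the
  primes dividing \<open>A * B\<close>.\<close>

locale prime_triple =
  fixes A B c d :: int
  assumes A_pos: "0 < A" and B_pos: "0 < B"
    and c_nonneg: "0 \<le> c" and c_less: "c < B"
    and bezout: "A * c - B * d = 1"
    and prime_dvd_AB: "\<And>l. prime l \<Longrightarrow> l dvd A * B \<longleftrightarrow> l = 2 \<or> l = 3"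
begin

text \<open>The indices 1, 2, 3 belong to \<open>q\<close>, \<open>r\<close>, \<open>p\<close>.
  Every other index falls to the form for \<open>p\<close>, so the facts below hold for all
  \<open>i\<close>.\<close>

definition slope :: "nat \<Rightarrow> int" where
  "slope i = (if i = 1 then B else if i = 2 then A else 2 * A * B)"

definition intercept :: "nat \<Rightarrow> int" where
  "intercept i = (if i = 1 then c else if i = 2 then d else 2 * A * c - 1)"

text \<open>The value -1 does occur: \<open>B = 1\<close> forces \<open>c = 0\<close> and
  \<open>d = -1\<close>.\<close>

lemma d_ge: "-1 \<le> d"
proof (rule ccontr)
  assume "\<not> -1 \<le> d"
  then have "B * d \<le> B * (-2)" using B_pos by (intro mult_left_mono) auto
  moreover have "0 \<le> A * c" using A_pos c_nonneg by simp
  ultimately show False using bezout B_pos by linarith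
qed

lemma d_less: "d < A"
proof -
  have "B * d < B * A"
    using bezout mult_strict_left_mono[OF c_less A_pos] by (simp add: mult.commute)
  then show ?thesis using B_pos by simp
qed

text \<open>A single quantity controls all six coefficients, so the size condition of the conjecture
  becomes a condition on \<open>2 * A * B\<close> alone.\<close>

lemma intercept_bounds: "\<bar>intercept i\<bar> \<le> 2 * A * B" and slope_bounds: "\<bar>slope i\<bar> \<le> 2 * A * B"
  and slope_pos: "0 < slope i" 
proof -
  have AB: "A \<le> A * B" "B \<le> A * B" "0 < A * B" using A_pos B_pos by auto
  have "A * c \<le> A * B" "0 \<le> A * c" using A_pos c_less c_nonneg by auto
  with AB have "\<bar>intercept i\<bar> \<le> 2 * (A * B)"
    using d_ge d_less c_nonneg c_less A_pos unfolding intercept_def mult.assoc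
    by (simp split: if_split; linarith)
  then show "\<bar>intercept i\<bar> \<le> 2 * A * B" by (simp only: mult.assoc)
  have "\<bar>slope i\<bar> \<le> 2 * (A * B) \<and> 0 < slope i"
    using AB A_pos B_pos unfolding slope_def mult.assoc
    by (simp split: if_split; linarith)
  then show "\<bar>slope i\<bar> \<le> 2 * A * B" "0 < slope i" by (simp_all only: mult.assoc)
qed

text \<open>The first two forms are primitive by the Bezout identity. For the third,
  \<open>(2*A*c - 1)^2 - 2*A*B * (2*c*d) = 1\<close>, again by Bezout.\<close>

lemma gcd_slope_intercept: "gcd (slope i) (intercept i) = 1"
proof -
  have "coprime B c" "coprime A d"
    by (rule coprimeI, subst bezout[symmetric], intro dvd_diff, simp, simp)+
  moreover have "coprime (2 * A * B) (2 * A * c - 1)"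
  proof (rule coprimeI)
    fix e assume e: "e dvd 2 * A * B" "e dvd 2 * A * c - 1"
    have "e dvd (2 * A * c - 1) * (2 * A * c - 1) - 2 * A * B * (2 * c * d)"
      by (rule dvd_diff[OF dvd_mult2[OF e(2)] dvd_mult2[OF e(1)]])
    also have "\<dots> = 1 + 4 * A * c * (A * c - B * d - 1)"
      by (simp add: algebra_simps)
    finally show "e dvd 1" using bezout by simp
  qed
  ultimately show ?thesis
    by (auto simp: slope_def intercept_def)
qed

lemma prod_forms:
  "(\<Prod>i=1..3. slope i * n + intercept i)
     = (B * n + c) * (A * n + d) * (2 * A * B * n + (2 * A * c - 1))"
proof -
  have "{1..3::nat} = {1,2,3}" by auto
  then show ?thesis by (simp add: slope_def intercept_def)
qed

text \<open>The forms satisfy \<open>A*q - B*r = 1\<close>, \<open>p = 2*A*q - 1\<close> and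
  \<open>p = 2*B*r + 1\<close>. A prime \<open>l\<close> in {2, 3} divides exactly one of
  \<open>A\<close>, \<open>B\<close>. If it divides \<open>A\<close>, then \<open>r\<close> is
  congruent to \<open>d\<close>, which is nonzero, and \<open>p\<close> to -1, so only
  \<open>q\<close> has a root; the case of \<open>B\<close> is symmetric. For any other
  \<open>l\<close> all three slopes are invertible, and a common root of two forms would make
  \<open>l\<close> divide 1.\<close>

lemma root_count_eq:
  assumes l: "prime l"
  shows "root_count 3 slope intercept l = (if l = 2 \<or> l = 3 then 1 else 3)"
proof -
  let ?l = "int l"
  have pl: "prime ?l" using l by simp
  define S where "S = {n \<in> {0..<?l}. ?l dvd (B * n + c) \<or> ?l dvd (A * n + d)
     \<or> ?l dvd (2 * A * B * n + (2 * A * c - 1))}"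
  have rc: "root_count 3 slope intercept l = card S"
    unfolding root_count_def S_def prod_forms cong_0_iff prime_dvd_mult_iff[OF pl]
    by (simp only: disj_assoc)
  have dvd_iff: "?l dvd A * B \<longleftrightarrow> l = 2 \<or> l = 3"
    using prime_dvd_AB[OF pl] by linarith
  have not1: "\<not> ?l dvd 1" using pl not_prime_unit by blast
  have not_both: "\<not> (?l dvd A \<and> ?l dvd B)"
    using not1 bezout by (metis dvd_diff dvd_mult2)
  have coprime_consec: "\<not> (?l dvd m \<and> ?l dvd m + 1)" "\<not> (?l dvd m \<and> ?l dvd m - 1)" for m
    using not1 dvd_diff[of ?l "m + 1" m] dvd_diff[of ?l m "m - 1"] by auto
  have p_q: "2 * A * B * n + (2 * A * c - 1) = 2 * A * (B * n + c) - 1" for n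
    by (simp add: algebra_simps)
  have p_r: "2 * A * B * n + (2 * A * c - 1) = 2 * B * (A * n + d) + 1" for n
    using bezout by (simp add: algebra_simps)
  show ?thesis
  proof (cases "l = 2 \<or> l = 3")
    case True
    then have "?l dvd A \<or> ?l dvd B" using dvd_iff pl by (simp add: prime_dvd_mult_iff)
    then obtain m where "S = {m}"
    proof
      assume lA: "?l dvd A"
      then have lB: "\<not> ?l dvd B" using not_both by blast
      have "\<not> ?l dvd d"
      proof
        assume "?l dvd d"
        then have "?l dvd A * c - B * d" using lA by simp
        then show False using bezout not1 by simp
      qed
      then have "\<not> ?l dvd A * n + d" for n
        using lA by (simp add: dvd_add_right_iff)
      moreover have "\<not> ?l dvd 2 * A * (B * n + c) - 1" for n
        using lA coprime_consec(2)[of "2 * A * (B * n + c)"] by auto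
      moreover obtain m where "m \<in> {0..<?l}"
        "\<And>n. n \<in> {0..<?l} \<Longrightarrow> ?l dvd B * n + c \<longleftrightarrow> n = m"
        using linear_root_unique[OF pl lB] by blast
      ultimately show thesis
        by (intro that[of m]) (auto simp: S_def p_q)
    next
      assume lB: "?l dvd B"
      then have lA: "\<not> ?l dvd A" using not_both by blast
      have "\<not> ?l dvd c"
      proof
        assume "?l dvd c"
        then have "?l dvd A * c - B * d" using lB by simp
        then show False using bezout not1 by simp
      qed
      then have "\<not> ?l dvd B * n + c" for n
        using lB by (simp add: dvd_add_right_iff)
      moreover have "\<not> ?l dvd 2 * B * (A * n + d) + 1" for n
        using lB coprime_consec(1)[of "2 * B * (A * n + d)"] by auto
      moreover obtain m where "m \<in> {0..<?l}"
        "\<And>n. n \<in> {0..<?l} \<Longrightarrow> ?l dvd A * n + d \<longleftrightarrow> n = m"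
        using linear_root_unique[OF pl lA] by blast
      ultimately show thesis
        by (intro that[of m]) (auto simp: S_def p_r)
    qed
    with True rc show ?thesis by auto
  next
    case False
    then have lA: "\<not> ?l dvd A" and lB: "\<not> ?l dvd B" using dvd_iff by auto
    have l2: "\<not> ?l dvd 2" 
      using False primes_dvd_imp_eq[OF l two_is_prime_nat] int_dvd_int_iff[of l 2] by auto
    then have lAB: "\<not> ?l dvd 2 * A * B" using lA lB pl by (simp add: prime_dvd_mult_iff)
    obtain m1 where m1: "m1 \<in> {0..<?l}"
        "\<And>n. n \<in> {0..<?l} \<Longrightarrow> ?l dvd B * n + c \<longleftrightarrow> n = m1"
      using linear_root_unique[OF pl lB] by blast
    obtain m2 where m2: "m2 \<in> {0..<?l}"
        "\<And>n. n \<in> {0..<?l} \<Longrightarrow> ?l dvd A * n + d \<longleftrightarrow> n = m2"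
      using linear_root_unique[OF pl lA] by blast
    obtain m3 where m3: "m3 \<in> {0..<?l}"
        "\<And>n. n \<in> {0..<?l} \<Longrightarrow> ?l dvd 2 * A * B * n + (2 * A * c - 1) \<longleftrightarrow> n = m3"
      using linear_root_unique[OF pl lAB] by blast
    have S: "S = {m1, m2, m3}" using m1 m2 m3 by (auto simp: S_def)
    have "m1 \<noteq> m2"
    proof
      assume "m1 = m2"
      then have "?l dvd A * (B * m1 + c) - B * (A * m1 + d)"
        using m1 m2 by (intro dvd_diff dvd_mult) auto
      also have "A * (B * m1 + c) - B * (A * m1 + d) = 1" using bezout by (simp add: algebra_simps)
      finally show False using not1 by simp
    qed
    moreover have "m1 \<noteq> m3"
    proof
      assume "m1 = m3"
      then have "?l dvd 2 * A * (B * m1 + c)" "?l dvd 2 * A * (B * m1 + c) - 1"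
        using m1(1) m1(2)[of m1] m3(2)[of m1] unfolding p_q by auto
      then show False using coprime_consec(2) by blast
    qed
    moreover have "m2 \<noteq> m3"
    proof
      assume "m2 = m3"
      then have "?l dvd 2 * B * (A * m2 + d)" "?l dvd 2 * B * (A * m2 + d) + 1"
        using m2(1) m2(2)[of m2] m3(2)[of m2] unfolding p_r by auto
      then show False using coprime_consec(1) by blast
    qed
    ultimately show ?thesis using S rc False by simp
  qed
qed

text \<open>One root at 2 and at 3 gives the local factors \<open>(1/2) / (1/2)^3 = 4\<close> and
  \<open>(2/3) / (2/3)^3 = 9/4\<close>, whose product is the 9 in \<open>singular_series_A\<close>.
  As a separate finitely supported factor they leave the product over \<open>p >= 5\<close>
  intact.\<close>

lemma singular_factor_eq:
  "singular_factor 3 slope intercept p =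
     (if prime p \<and> 5 \<le> p then (1 - 3 / real p) * inverse ((1 - 1 / real p) ^ 3) else 1)
     * (if p \<in> {2,3} then (if p = 2 then 4 else 9/4) else 1)"
proof (cases "prime p")
  case True
  then have "p \<ge> 2" "p \<noteq> 4" using prime_ge_2_nat by auto
  then consider "p = 2" | "p = 3" | "p \<ge> 5" by linarith
  then show ?thesis
    using True by cases (auto simp: singular_factor_def root_count_eq power_numeral_reduce)
qed (auto simp: singular_factor_def)

lemma convergent_prod_singular_factor: "convergent_prod (singular_factor 3 slope intercept)"
  unfolding singular_factor_eq[abs_def]
  by (intro convergent_prod_mult convergent_prod_A_factor convergent_prod_If_finite_set) simp

lemma singular_series_eq: "singular_series 3 slope intercept = singular_series_A"
proof -
  let ?G = "\<lambda>p::nat. if p \<in> {2,3} then (if p = 2 then 4 else 9/4) else (1::real)"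
  have "prodinf ?G = (\<Prod>p\<in>{2,3}. ?G p)"
    by (rule prodinf_finite) auto
  then have G: "prodinf ?G = 9" by simp
  have "convergent_prod ?G" by (rule convergent_prod_If_finite_set) simp
  from prodinf_mult[OF convergent_prod_A_factor this]
  show ?thesis
    unfolding singular_series_def singular_factor_eq[abs_def] singular_series_A_def G
    by simp
qed

end

section \<open>Primes in one class\<close>

lemma finite_nats_le_real: "finite {n::nat. 1 \<le> n \<and> real n \<le> y \<and> P n}"
  by (rule finite_subset[of _ "{..nat \<lfloor>y\<rfloor>}"]) (auto simp: le_nat_floor)

text \<open>This trivial bound replaces the conjecture when the modulus is too large for it.
  Counting from \<open>n = 1\<close> keeps the bound at \<open>y\<close> even for
  \<open>y < 1\<close>.\<close>

lemma prime_tuple_count_le: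
  assumes "0 \<le> y"
  shows "real (prime_tuple_count R a b y) \<le> y"
proof -
  have "prime_tuple_count R a b y \<le> card {1..nat \<lfloor>y\<rfloor>}"
    unfolding prime_tuple_count_def by (intro card_mono) (auto simp: le_nat_floor)
  then show ?thesis using assms by simp linarith
qed

context prime_triple
begin

definition modulus :: real where
  "modulus = 2 * of_int A * of_int B"

text \<open>
  The value \<open>n = 0\<close> is left out: it can produce a prime below \<open>X\<close> even when the modulus is far larger
  than \<open>X\<close>, which would destroy the uniform bound \<open>X / modulus\<close>.
\<close>
definition class_primes :: "real \<Rightarrow> nat set" where
  "class_primes X = {p. \<exists>n::nat. 1 \<le> n \<and> int p = 2 * A * B * int n + (2 * A * c - 1) \<and> prime p
     \<and> prime (B * int n + c) \<and> B * int n + c \<notin> {2, 3}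
     \<and> prime (A * int n + d) \<and> A * int n + d \<notin> {2, 3} \<and> real p + 1 \<le> X}"

lemma modulus_pos: "0 < modulus"
  using A_pos B_pos by (simp add: modulus_def)

lemma prime_tuple_count_eq:
  "prime_tuple_count 3 slope intercept y = card {n::nat. 1 \<le> n \<and> real n \<le> y \<and>
     prime (B * int n + c) \<and> prime (A * int n + d) \<and> prime (2 * A * B * int n + (2 * A * c - 1))}"
proof -
  have "{1..3::nat} = {1,2,3}" by auto
  then show ?thesis by (simp add: prime_tuple_count_def slope_def intercept_def)
qed

lemma finite_class_primes: "finite (class_primes X)"
  by (rule finite_subset[of _ "{..nat \<lfloor>X\<rfloor>}"]) (auto simp: class_primes_def le_nat_floor)

text \<open>Since \<open>2*A*c >= 0\<close>, the prime with parameter \<open>n\<close> satisfies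
  \<open>p + 1 >= modulus * n\<close>.\<close>

lemma card_class_primes_le:
  "card (class_primes X) \<le> prime_tuple_count 3 slope intercept (X / modulus)"
  unfolding prime_tuple_count_eq
proof (rule surj_card_le[OF finite_nats_le_real], rule subsetI)
  fix p assume "p \<in> class_primes X"
  then obtain n where n: "1 \<le> n" "int p = 2 * A * B * int n + (2 * A * c - 1)" "prime p"
     "prime (B * int n + c)" "prime (A * int n + d)" "real p + 1 \<le> X"
    unfolding class_primes_def by blast
  have "0 \<le> A * c" using A_pos c_nonneg by simp
  then have "2 * A * B * int n \<le> int p + 1" using n(2) by linarith
  then have "real_of_int (2 * A * B * int n) \<le> real_of_int (int p + 1)"
    by (simp only: of_int_le_iff)
  then have "modulus * real n \<le> X" using n(6) by (simp add: modulus_def)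
  then have "real n \<le> X / modulus" using modulus_pos by (simp add: field_simps)
  moreover have "prime (2 * A * B * int n + (2 * A * c - 1))"
    using n(3) unfolding n(2)[symmetric] by simp
  ultimately show "p \<in> (\<lambda>n. nat (2 * A * B * int n + (2 * A * c - 1))) ` {n::nat. 1 \<le> n \<and>
     real n \<le> X / modulus \<and> prime (B * int n + c) \<and> prime (A * int n + d) \<and>
     prime (2 * A * B * int n + (2 * A * c - 1))}"
    using n(1,4,5) by (intro image_eqI[of _ _ n]) (simp_all only: n(2)[symmetric] nat_int mem_Collect_eq simp_thms)
qed

text \<open>Since \<open>c < B\<close>, the prime with parameter \<open>n\<close> satisfies
  \<open>p + 1 <= modulus * (n + 1)\<close>, which explains the shift by 1. The loss of 4 pays for
  the parameters at which \<open>q\<close> or \<open>r\<close> is 2 or 3.\<close>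

lemma card_class_primes_ge:
  "real (prime_tuple_count 3 slope intercept (X / modulus - 1)) - 4 \<le> real (card (class_primes X))"
proof -
  let ?T = "{n::nat. 1 \<le> n \<and> real n \<le> X / modulus - 1 \<and>
     prime (B * int n + c) \<and> prime (A * int n + d) \<and> prime (2 * A * B * int n + (2 * A * c - 1))}"
  \<comment> \<open>Each equation \<open>u * n + v = z\<close> has at most one solution, and if
    there is one, the quotient finds it. Entries that solve nothing only weaken the count.\<close>
  let ?E = "{nat ((2 - c) div B), nat ((3 - c) div B), nat ((2 - d) div A), nat ((3 - d) div A)}"
  let ?g = "\<lambda>n::nat. nat (2 * A * B * int n + (2 * A * c - 1))"
  have inj: "inj_on ?g ?T"
  proof (rule inj_onI)
    fix m n assume "m \<in> ?T" "n \<in> ?T" and eq: "?g m = ?g n"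
    then have "0 \<le> 2 * A * B * int m + (2 * A * c - 1)" "0 \<le> 2 * A * B * int n + (2 * A * c - 1)"
      using prime_ge_0_int by blast+
    then have "2 * A * B * int m = 2 * A * B * int n" using eq by linarith
    then show "m = n" using A_pos B_pos by simp
  qed
  have "?g ` (?T - ?E) \<subseteq> class_primes X"
  proof (rule image_subsetI)
    fix n assume n: "n \<in> ?T - ?E"
    define P where "P = 2 * A * B * int n + (2 * A * c - 1)"
    have nT: "1 \<le> n" "real n \<le> X / modulus - 1" "prime (B * int n + c)" "prime (A * int n + d)"
      and P: "prime P"
      using n unfolding P_def by (simp_all only: Diff_iff mem_Collect_eq)
    have P0: "0 \<le> P" using P prime_ge_0_int by blast
    have "A * c \<le> A * B" using A_pos c_less by simp
    then have "P + 1 \<le> 2 * A * B * (int n + 1)" by (simp add: P_def algebra_simps)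
    then have "real_of_int (P + 1) \<le> real_of_int (2 * A * B * (int n + 1))"
      by (simp only: of_int_le_iff)
    then have "real_of_int P + 1 \<le> modulus * (real n + 1)" by (simp add: modulus_def)
    also have "\<dots> \<le> X" using nT(2) modulus_pos by (simp add: field_simps)
    finally have PX: "real (nat P) + 1 \<le> X" using P0 by simp
    have linear_ne: "u * int n + v \<noteq> z" if "0 < u" "n \<noteq> nat ((z - v) div u)" for u v z
    proof
      assume "u * int n + v = z"
      then have "(z - v) div u = int n" using \<open>0 < u\<close> by auto
      then show False using that by simp
    qed
    have nE: "n \<notin> ?E" using n by (simp only: Diff_iff simp_thms)
    then have "n \<noteq> nat ((2 - c) div B)" "n \<noteq> nat ((3 - c) div B)"
      "n \<noteq> nat ((2 - d) div A)" "n \<noteq> nat ((3 - d) div A)"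
      by (simp_all only: insert_iff de_Morgan_disj simp_thms)
    then have ne: "B * int n + c \<noteq> 2" "B * int n + c \<noteq> 3" "A * int n + d \<noteq> 2" "A * int n + d \<noteq> 3"
      by - (rule linear_ne[OF B_pos] linear_ne[OF A_pos], assumption)+
    have "prime (nat P)" using P by (simp only: prime_int_nat_transfer)
    then have "1 \<le> n \<and> int (nat P) = 2 * A * B * int n + (2 * A * c - 1) \<and> prime (nat P)
     \<and> prime (B * int n + c) \<and> B * int n + c \<notin> {2, 3}
     \<and> prime (A * int n + d) \<and> A * int n + d \<notin> {2, 3} \<and> real (nat P) + 1 \<le> X"
      using nT PX P0 ne unfolding P_def[symmetric] by simp
    then have "nat P \<in> class_primes X"
      unfolding class_primes_def by - (rule CollectI, rule exI[of _ n], assumption)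
    then show "?g n \<in> class_primes X"
      by (simp only: P_def)
  qed
  then have "card (?g ` (?T - ?E)) \<le> card (class_primes X)"
    by (rule card_mono[OF finite_class_primes])
  moreover have "card (?g ` (?T - ?E)) = card (?T - ?E)"
    by (intro card_image inj_on_subset[OF inj]) blast
  moreover have "card ?T - card ?E \<le> card (?T - ?E)" by (rule diff_card_le_card_Diff) simp
  moreover have "card ?E \<le> 4" by (simp add: card_insert_if)
  ultimately have "card ?T \<le> card (class_primes X) + 4" by linarith
  then show ?thesis unfolding prime_tuple_count_eq by linarith
qed

end

text \<open>
  The exponent 7 leaves room for a modulus up to \<open>(ln X)^6\<close> when the conjecture is applied at
  \<open>y = X / modulus\<close>, where \<open>ln y \<ge> ln X / 2\<close>.
\<close>
lemma generalized_Hardy_LittlewoodE: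
  assumes "generalized_Hardy_Littlewood"
  obtains E1 E2 :: "real \<Rightarrow> real" where "(E1 \<longlongrightarrow> 0) at_top" "(E2 \<longlongrightarrow> 0) at_top"
    "\<And>A B c d y. prime_triple A B c d \<Longrightarrow> 1 < y \<Longrightarrow> prime_triple.modulus A B \<le> ln y ^ 7 \<Longrightarrow>
       \<bar>real (prime_tuple_count 3 (prime_triple.slope A B) (prime_triple.intercept A c d) y)
          * ln y ^ 3 / y - singular_series_A\<bar> \<le> E1 y * \<bar>singular_series_A\<bar> + E2 y"
proof -
  from assms[unfolded generalized_Hardy_Littlewood_def, rule_format, of 3 7]
  obtain E1 E2 :: "real \<Rightarrow> real" where E: "(E1 \<longlongrightarrow> 0) at_top" "(E2 \<longlongrightarrow> 0) at_top"
    and HL: "\<And>a b x. (\<forall>i\<in>{1..3}. gcd (a i) (b i) = 1 \<and> 0 < a i) \<Longrightarrow>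
             convergent_prod (singular_factor 3 a b) \<Longrightarrow> 1 < x \<Longrightarrow>
                (\<forall>i\<in>{1..3}. real_of_int \<bar>a i\<bar> \<le> ln x powr 7
                          \<and> real_of_int \<bar>b i\<bar> \<le> ln x powr 7) \<Longrightarrow>
                (\<exists>d1 d2 :: real. \<bar>d1\<bar> \<le> E1 x \<and> \<bar>d2\<bar> \<le> E2 x \<and>
                   real (prime_tuple_count 3 a b x) =
                     (1 + d1) * singular_series 3 a b * (x / ln x ^ 3)
                       + d2 * (x / ln x ^ 3))"
    by auto
  show thesis
  proof (rule that[OF E])
    fix A B c d :: int and y :: real
    assume "prime_triple A B c d" and y: "1 < y" and m: "prime_triple.modulus A B \<le> ln y ^ 7"
    then interpret prime_triple A B c d by simp
    have ly: "0 < ln y" using y by simp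
    have powr: "ln y powr 7 = ln y ^ 7" using ly by (simp add: powr_numeral)
    have "real_of_int (2 * A * B) \<le> ln y powr 7" using m by (simp add: powr modulus_def)
    then have "real_of_int \<bar>slope i\<bar> \<le> ln y powr 7 \<and> real_of_int \<bar>intercept i\<bar> \<le> ln y powr 7" for i
      using slope_bounds[of i] intercept_bounds[of i]
      by (meson of_int_le_iff order_trans)
    then obtain d1 d2 :: real where d12: "\<bar>d1\<bar> \<le> E1 y" "\<bar>d2\<bar> \<le> E2 y" and
      "real (prime_tuple_count 3 slope intercept y) =
                     (1 + d1) * singular_series_A * (y / ln y ^ 3) + d2 * (y / ln y ^ 3)"
      using HL[of slope intercept y] gcd_slope_intercept slope_pos convergent_prod_singular_factor y
      unfolding singular_series_eq by blast
    then have "real (prime_tuple_count 3 slope intercept y) * ln y ^ 3 / y - singular_series_A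
       = d1 * singular_series_A + d2"
      using y ly by (simp add: field_simps)
    also have "\<bar>\<dots>\<bar> \<le> E1 y * \<bar>singular_series_A\<bar> + E2 y"
      using d12 by (intro order_trans[OF abs_triangle_ineq] add_mono)
        (auto simp: abs_mult intro!: mult_right_mono)
    finally show "\<bar>real (prime_tuple_count 3 slope intercept y) * ln y ^ 3 / y - singular_series_A\<bar>
       \<le> E1 y * \<bar>singular_series_A\<bar> + E2 y" .
  qed
qed

text \<open>For a fixed triple the modulus is constant, so \<open>ln y ^ 7\<close> exceeds it
  eventually and the uniform estimate applies.\<close>

lemma (in prime_triple) prime_tuple_count_tendsto:
  assumes "generalized_Hardy_Littlewood"
  shows "((\<lambda>y. real (prime_tuple_count 3 slope intercept y) * ln y ^ 3 / y)
           \<longlongrightarrow> singular_series_A) at_top"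
proof -
  obtain E1 E2 :: "real \<Rightarrow> real" where E: "(E1 \<longlongrightarrow> 0) at_top" "(E2 \<longlongrightarrow> 0) at_top" and
   HL: "\<And>y. 1 < y \<Longrightarrow> modulus \<le> ln y ^ 7 \<Longrightarrow>
       \<bar>real (prime_tuple_count 3 slope intercept y)
          * ln y ^ 3 / y - singular_series_A\<bar> \<le> E1 y * \<bar>singular_series_A\<bar> + E2 y"
    using generalized_Hardy_LittlewoodE[OF assms] prime_triple_axioms by metis
  have "filterlim (\<lambda>y::real. ln y ^ 7) at_top at_top" by real_asymp
  then have "eventually (\<lambda>y. modulus \<le> ln y ^ 7) at_top"
    by (simp add: filterlim_at_top)
  then have "eventually (\<lambda>y. norm (real (prime_tuple_count 3 slope intercept y)
          * ln y ^ 3 / y - singular_series_A) \<le> E1 y * \<bar>singular_series_A\<bar> + E2 y) at_top"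
    using eventually_gt_at_top[of 1] by eventually_elim (use HL in auto)
  moreover have "((\<lambda>y. E1 y * \<bar>singular_series_A\<bar> + E2 y) \<longlongrightarrow> 0) at_top"
    by (rule tendsto_eq_intros E refl | simp)+
  ultimately have "((\<lambda>y. real (prime_tuple_count 3 slope intercept y)
          * ln y ^ 3 / y - singular_series_A) \<longlongrightarrow> 0) at_top"
    by (rule Lim_null_comparison)
  then show ?thesis by (simp add: LIM_zero_iff)
qed

text \<open>The count is squeezed between the tuple counts at \<open>X / modulus - 1\<close>, minus
  4, and at \<open>X / modulus\<close>. Passing from the normalisation at these points to the one at
  \<open>X\<close> contributes the limit \<open>1 / modulus\<close>, because
  \<open>ln (X / modulus)\<close> is asymptotic to \<open>ln X\<close>.\<close>

lemma (in prime_triple) class_primes_tendsto: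
  assumes "generalized_Hardy_Littlewood"
  shows "((\<lambda>X. real (card (class_primes X)) * ln X ^ 3 / X) \<longlongrightarrow> singular_series_A / modulus) at_top"
proof -
  note lim = prime_tuple_count_tendsto[OF assms]
  define P where "P y = real (prime_tuple_count 3 slope intercept y)" for y
  have m: "0 < modulus" by (rule modulus_pos)
  have cancel: "a * L / y * (y * l / (L * X)) = a * l / X" if "y \<noteq> 0" "L \<noteq> 0" for a L y l X :: real
    using that by simp
  have "filterlim (\<lambda>X. X / modulus) at_top at_top" using m by real_asymp
  note comp = filterlim_compose[OF lim this]
  have ratio: "((\<lambda>X. (X / modulus) * ln X ^ 3 / (ln (X / modulus) ^ 3 * X)) \<longlongrightarrow> 1 / modulus) at_top"
    unfolding inverse_eq_divide[symmetric] using m by real_asymp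
  have "((\<lambda>X. P (X / modulus) * ln (X / modulus) ^ 3 / (X / modulus)
       * ((X / modulus) * ln X ^ 3 / (ln (X / modulus) ^ 3 * X)))
        \<longlongrightarrow> singular_series_A * (1 / modulus)) at_top"
    unfolding P_def by (rule tendsto_mult[OF comp ratio])
  moreover have "eventually (\<lambda>X. P (X / modulus) * ln (X / modulus) ^ 3 / (X / modulus)
       * ((X / modulus) * ln X ^ 3 / (ln (X / modulus) ^ 3 * X)) = P (X / modulus) * ln X ^ 3 / X) at_top"
    using eventually_gt_at_top[of 1] eventually_gt_at_top[of modulus]
    by eventually_elim (rule cancel, use m in simp_all)
  ultimately have "((\<lambda>X. P (X / modulus) * ln X ^ 3 / X) \<longlongrightarrow> singular_series_A * (1 / modulus)) at_top"
    by (rule Lim_transform_eventually)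
  then have upper: "((\<lambda>X. P (X / modulus) * ln X ^ 3 / X) \<longlongrightarrow> singular_series_A / modulus) at_top"
    by simp
  have "filterlim (\<lambda>X. X / modulus - 1) at_top at_top" using m by real_asymp
  note comp = filterlim_compose[OF lim this]
  have ratio: "((\<lambda>X. (X / modulus - 1) * ln X ^ 3 / (ln (X / modulus - 1) ^ 3 * X))
      \<longlongrightarrow> 1 / modulus) at_top"
    unfolding inverse_eq_divide[symmetric] using m by real_asymp
  have err: "((\<lambda>X::real. 4 * (ln X ^ 3 / X)) \<longlongrightarrow> 0) at_top"
    by real_asymp
  have "((\<lambda>X. P (X / modulus - 1) * ln (X / modulus - 1) ^ 3 / (X / modulus - 1)
       * ((X / modulus - 1) * ln X ^ 3 / (ln (X / modulus - 1) ^ 3 * X)) - 4 * (ln X ^ 3 / X))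
        \<longlongrightarrow> singular_series_A * (1 / modulus) - 0) at_top"
    unfolding P_def by (rule tendsto_diff[OF tendsto_mult[OF comp ratio] err])
  moreover have "eventually (\<lambda>X. P (X / modulus - 1) * ln (X / modulus - 1) ^ 3 / (X / modulus - 1)
       * ((X / modulus - 1) * ln X ^ 3 / (ln (X / modulus - 1) ^ 3 * X)) - 4 * (ln X ^ 3 / X)
        = (P (X / modulus - 1) - 4) * ln X ^ 3 / X) at_top"
    \<comment> \<open>Beyond \<open>2 * modulus\<close> the argument \<open>z\<close> exceeds 1, so
      that \<open>ln z\<close> is positive and may be cancelled.\<close>
    using eventually_gt_at_top[of "2 * modulus"]
  proof eventually_elim
    case (elim X)
    define z where "z = X / modulus - 1"
    have "1 < z" using elim m by (simp add: z_def field_simps)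
    moreover from this have "0 < ln z" by (rule ln_gt_zero)
    ultimately show ?case unfolding z_def[symmetric]
      by (subst cancel) (simp_all add: left_diff_distrib diff_divide_distrib)
  qed
  ultimately have "((\<lambda>X. (P (X / modulus - 1) - 4) * ln X ^ 3 / X)
      \<longlongrightarrow> singular_series_A * (1 / modulus) - 0) at_top"
    by (rule Lim_transform_eventually)
  then have lower: "((\<lambda>X. (P (X / modulus - 1) - 4) * ln X ^ 3 / X)
      \<longlongrightarrow> singular_series_A / modulus) at_top"
    by simp
  show ?thesis
  proof (rule tendsto_sandwich[OF _ _ lower upper])
    show "eventually (\<lambda>X. (P (X / modulus - 1) - 4) * ln X ^ 3 / X \<le> real (card (class_primes X)) * ln X ^ 3 / X) at_top"
      using eventually_gt_at_top[of 1]
      by eventually_elim (use card_class_primes_ge in \<open>auto simp: P_def intro!: divide_right_mono mult_right_mono\<close>)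
    show "eventually (\<lambda>X. real (card (class_primes X)) * ln X ^ 3 / X \<le> P (X / modulus) * ln X ^ 3 / X) at_top"
      using eventually_gt_at_top[of 1]
      by eventually_elim (use card_class_primes_le in \<open>auto simp: P_def intro!: divide_right_mono mult_right_mono\<close>)
  qed
qed

text \<open>The threshold for \<open>X\<close> precedes the choice of the triple, as dominated
  convergence over all classes requires.\<close>

lemma class_primes_dominated:
  assumes "generalized_Hardy_Littlewood"
  obtains M where "eventually (\<lambda>X. \<forall>A B c d. prime_triple A B c d \<longrightarrow>
    real (card (prime_triple.class_primes A B c d X)) * ln X ^ 3 / X
      \<le> M / sqrt (prime_triple.modulus A B)) at_top"
proof -
  obtain E1 E2 :: "real \<Rightarrow> real" where E: "(E1 \<longlongrightarrow> 0) at_top" "(E2 \<longlongrightarrow> 0) at_top" and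
   HL: "\<And>A B c d y. prime_triple A B c d \<Longrightarrow> 1 < y \<Longrightarrow> prime_triple.modulus A B \<le> ln y ^ 7 \<Longrightarrow>
       \<bar>real (prime_tuple_count 3 (prime_triple.slope A B) (prime_triple.intercept A c d) y)
          * ln y ^ 3 / y - singular_series_A\<bar> \<le> E1 y * \<bar>singular_series_A\<bar> + E2 y"
    using generalized_Hardy_LittlewoodE[OF assms] by metis
  \<comment> \<open>Once \<open>E1\<close> and \<open>E2\<close> are below 1, the normalised tuple
    count differs from \<open>singular_series_A\<close> by at most its absolute value plus
    1.\<close>
  define S where "S = 2 * \<bar>singular_series_A\<bar> + 1"
  have S: "1 \<le> S" by (simp add: S_def)
  have "eventually (\<lambda>y. E1 y < 1) at_top" "eventually (\<lambda>y. E2 y < 1) at_top"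
    using E by (auto intro: order_tendstoD)
  then have "eventually (\<lambda>y. E1 y < 1 \<and> E2 y < 1) at_top" by (rule eventually_conj)
  then obtain y0 where y0: "\<And>y. y0 \<le> y \<Longrightarrow> E1 y < 1 \<and> E2 y < 1"
    by (auto simp: eventually_at_top_linorder)
  have e1: "eventually (\<lambda>X. max 1 y0 < sqrt X) at_top"
    by (rule filterlim_at_top_dense[THEN iffD1, OF sqrt_at_top, rule_format])
  have e2: "eventually (\<lambda>X::real. ln X ^ 6 \<le> sqrt X) at_top" by real_asymp
  \<comment> \<open>The constant is \<open>2 ^ 7\<close>: it yields
    \<open>ln X ^ 6 <= (ln X / 2) ^ 7\<close>.\<close>
  have e3: "eventually (\<lambda>X::real. 128 \<le> ln X) at_top" by real_asymp
  have "eventually (\<lambda>X. \<forall>A B c d. prime_triple A B c d \<longrightarrow>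
    real (card (prime_triple.class_primes A B c d X)) * ln X ^ 3 / X
      \<le> 8 * S / sqrt (prime_triple.modulus A B)) at_top"
    using e1 e2 e3 eventually_gt_at_top[of 1]
  proof eventually_elim
    case (elim X)
    show ?case
    proof (intro allI impI)
      fix A B c d :: int
      assume triple: "prime_triple A B c d"
      interpret prime_triple A B c d by (rule triple)
      let ?K = "real (card (class_primes X))"
      have "modulus \<ge> 1"
      proof -
        have "0 < A * B" using A_pos B_pos by simp
        then have "1 \<le> 2 * (A * B)" by linarith
        then have "1 \<le> real_of_int (2 * (A * B))" by (simp only: of_int_1_le_iff)
        then show ?thesis by (simp add: modulus_def)
      qed
      then have sq: "0 < sqrt modulus" "sqrt modulus \<le> modulus" "modulus = sqrt modulus * sqrt modulus"
        by (auto simp: real_sqrt_le_iff intro!: real_le_lsqrt self_le_power)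
      have KP: "?K \<le> real (prime_tuple_count 3 slope intercept (X / modulus))"
        using card_class_primes_le by simp
      have lX: "0 < ln X" "0 < X" using elim by auto
      show "?K * ln X ^ 3 / X \<le> 8 * S / sqrt modulus"
      proof (cases "modulus \<le> ln X ^ 6")
        case True
        define y where "y = X / modulus"
        \<comment> \<open>Here \<open>modulus <= ln X ^ 6 <= sqrt X\<close>, so
          \<open>y >= sqrt X\<close> lies beyond \<open>y0\<close> whatever the triple.\<close>
        have "X = sqrt X * sqrt X" using lX by simp
        also have "\<dots> \<ge> sqrt X * modulus" using True elim by (intro mult_left_mono) auto
        finally have sy: "sqrt X \<le> y" using modulus_pos by (simp add: y_def field_simps)
        then have y1: "1 < y" "y0 \<le> y" using elim(1) unfolding max_less_iff_conj by linarith+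
        have "ln (sqrt X) \<le> ln y" using sy y1 lX by (subst ln_le_cancel_iff) auto
        then have ly: "ln X / 2 \<le> ln y" using lX by (simp add: ln_sqrt)
        have "ln X ^ 6 \<le> ln X ^ 6 * (ln X / 128)" using elim lX by simp
        also have "\<dots> = (ln X / 2) ^ 7"
          using power_add[of "ln X" 6 1] by (simp add: power_divide)
        also have "\<dots> \<le> ln y ^ 7" using ly lX by (intro power_mono) auto
        finally have "modulus \<le> ln y ^ 7" using True by linarith
        from HL[OF triple y1(1) this]
        have "real (prime_tuple_count 3 slope intercept y) * ln y ^ 3 / y
          \<le> \<bar>singular_series_A\<bar> + (E1 y * \<bar>singular_series_A\<bar> + E2 y)"
          by linarith
        also have "\<dots> \<le> S"
        proof -
          have "E1 y * \<bar>singular_series_A\<bar> \<le> 1 * \<bar>singular_series_A\<bar>" "E2 y \<le> 1"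
            using y0[OF y1(2)] mult_right_mono[of "E1 y" 1 "\<bar>singular_series_A\<bar>"] by auto
          then show ?thesis by (simp add: S_def)
        qed
        finally have Py: "real (prime_tuple_count 3 slope intercept y) * ln y ^ 3 / y \<le> S" .
        \<comment> \<open>From \<open>ln X <= 2 * ln y\<close> comes the factor
          \<open>2 ^ 3 = 8\<close>. The result is even of order \<open>1 / modulus\<close>; the
          square root is needed only for large moduli.\<close>
        have "?K * ln X ^ 3 / X \<le> real (prime_tuple_count 3 slope intercept y) * (2 * ln y) ^ 3 / X"
          using KP ly lX by (intro divide_right_mono mult_mono power_mono) (auto simp: y_def)
        also have "\<dots> = 8 * (real (prime_tuple_count 3 slope intercept y) * ln y ^ 3 / y) / modulus"
          using lX modulus_pos by (simp add: y_def power_mult_distrib)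
        also have "\<dots> \<le> 8 * S / sqrt modulus"
          using Py sq S by (intro frac_le) auto
        finally show ?thesis .
      next
        case False
        have "?K \<le> X / modulus"
          using KP prime_tuple_count_le[of "X / modulus"] lX modulus_pos by (smt (verit) divide_nonneg_pos)
        then have "?K * ln X ^ 3 / X \<le> (X / modulus) * ln X ^ 3 / X"
          using lX by (intro divide_right_mono mult_right_mono) auto
        also have "\<dots> = ln X ^ 3 / modulus" using lX by simp
        \<comment> \<open>The exponent 6 of the case distinction is chosen for this step:
          \<open>modulus > ln X ^ 6\<close> gives \<open>ln X ^ 3 <= sqrt modulus\<close>.\<close>
        also have "\<dots> \<le> sqrt modulus / modulus"
        proof (rule divide_right_mono)
          have "(ln X ^ 3)^2 \<le> modulus" using False by (simp flip: power_mult)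
          then show "ln X ^ 3 \<le> sqrt modulus" by (rule real_le_rsqrt)
        qed (use modulus_pos in auto)
        also have "\<dots> = 1 / sqrt modulus" using sq by (metis nonzero_divide_mult_cancel_left less_irrefl)
        also have "\<dots> \<le> 8 * S / sqrt modulus" using S sq by (intro divide_right_mono) auto
        finally show ?thesis .
      qed
    qed
  qed
  then show thesis by (rule that)
qed

section \<open>The family of all classes\<close>

text \<open>By the Weierstrass M-test the finite partial sums converge uniformly on the set of
  \<open>x\<close> where all bounds hold at once, so the limit along \<open>F\<close> and the limit
  over finite index sets may be exchanged.\<close>

lemma tannery_infsum:
  fixes f :: "'a \<Rightarrow> 'b \<Rightarrow> real"
  assumes lim: "\<And>i. (f i \<longlongrightarrow> g i) F"
    and dominated: "eventually (\<lambda>x. \<forall>i. \<bar>f i x\<bar> \<le> M i) F"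
    and M: "M summable_on UNIV" and g: "(g has_sum s) UNIV"
  shows "((\<lambda>x. \<Sum>\<^sub>\<infinity>i. f i x) \<longlongrightarrow> s) F"
proof (rule swap_uniform_limit')
  show "\<forall>\<^sub>F I in finite_subsets_at_top UNIV. ((\<lambda>x. \<Sum>i\<in>I. f i x) \<longlongrightarrow> (\<Sum>i\<in>I. g i)) F"
    by (intro always_eventually allI tendsto_sum lim)
  show "((\<lambda>I. \<Sum>i\<in>I. g i) \<longlongrightarrow> s) (finite_subsets_at_top UNIV)"
    using g by (simp add: has_sum_def)
  show "uniform_limit {x. \<forall>i. \<bar>f i x\<bar> \<le> M i} (\<lambda>I x. \<Sum>i\<in>I. f i x) (\<lambda>x. \<Sum>\<^sub>\<infinity>i. f i x)
      (finite_subsets_at_top UNIV)"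
    by (rule Weierstrass_m_test_general[OF _ M]) auto
  show "\<forall>\<^sub>F x in F. x \<in> {x. \<forall>i. \<bar>f i x\<bar> \<le> M i}"
    using dominated by simp
qed simp

text \<open>The summand ignores the flag \<open>e\<close>, whence the factor 2. One instance gives
  the limit of the normalised count, another the summable majorant.\<close>

lemma has_sum_geometric_index:
  fixes u v :: real
  assumes "0 \<le> u" "u < 1" "0 \<le> v" "v < 1"
  shows "((\<lambda>(e, k, j). u ^ k * v ^ j) has_sum 2 / ((1 - u) * (1 - v))) (UNIV :: (bool \<times> nat \<times> nat) set)"
proof -
  have geo: "((\<lambda>k. w ^ k) has_sum (1 / (1 - w))) UNIV" if "0 \<le> w" "w < 1" for w :: real
    using that by (intro sums_nonneg_imp_has_sum geometric_sums) auto
  have row: "((\<lambda>j. u ^ k * v ^ j) has_sum (u ^ k * (1 / (1 - v)))) UNIV" for k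
    using assms by (intro has_sum_cmult_right geo)
  have col: "((\<lambda>k. u ^ k * (1 / (1 - v))) has_sum (1 / (1 - u) * (1 / (1 - v)))) UNIV"
    using assms by (intro has_sum_cmult_left geo)
  have two: "((\<lambda>(k, j). u ^ k * v ^ j) has_sum (1 / (1 - u) * (1 / (1 - v)))) (UNIV \<times> UNIV)"
    using assms row col
    by (intro has_sum_SigmaI[where g = "\<lambda>k. u ^ k * (1 / (1 - v))"] summable_on_SigmaI)
      (auto simp: has_sum_imp_summable)
  have flag: "((\<lambda>e::bool. 1 / (1 - u) * (1 / (1 - v))) has_sum
      (\<Sum>e\<in>(UNIV :: bool set). 1 / (1 - u) * (1 / (1 - v)))) UNIV"
    by (rule has_sum_finite) simp
  let ?F = "\<lambda>(e::bool, k, j). u ^ k * v ^ j"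
  have two': "((\<lambda>y. ?F (e, y)) has_sum (1 / (1 - u) * (1 / (1 - v)))) (UNIV \<times> UNIV)" for e
    using two by simp
  have "(?F has_sum (\<Sum>e\<in>(UNIV :: bool set). 1 / (1 - u) * (1 / (1 - v)))) (UNIV \<times> UNIV \<times> UNIV)"
    by (rule has_sum_SigmaI[OF two' flag summable_on_SigmaI[OF two' has_sum_imp_summable[OF flag]]])
      (use assms in auto)
  moreover have "(\<Sum>e\<in>(UNIV :: bool set). 1 / (1 - u) * (1 / (1 - v))) = 2 / ((1 - u) * (1 - v))"
    by (simp add: UNIV_bool)
  ultimately show ?thesis by (simp only: UNIV_Times_UNIV)
qed

section \<open>Indexing the classes and separating them\<close>

lemma prime_power_mult_cancel:
  fixes p :: nat
  assumes "prime p" "\<not> p dvd u" "\<not> p dvd v" "p ^ a * u = p ^ b * v"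
  shows "a = b"
proof -
  have le: "b \<le> a" if "\<not> p dvd u" "p ^ a * u = p ^ b * v" for a b u v
  proof (rule ccontr)
    assume "\<not> b \<le> a"
    then have "p ^ b = p ^ a * p ^ (b - a)" "p dvd p ^ (b - a)"
      by (auto simp flip: power_add)
    then have "u = p ^ (b - a) * v" using that(2) \<open>prime p\<close> by (simp add: mult.assoc)
    then show False using that(1) \<open>p dvd p ^ (b - a)\<close> by simp
  qed
  show ?thesis using le[of u a b v] le[of v b a u] assms by simp
qed

text \<open>
  The index \<open>(e, k, j)\<close> stands for \<open>\<beta> = j + 1\<close> and \<open>(\<alpha>, \<gamma>) = (k + 2, 1)\<close> if \<open>e\<close>,
  \<open>(\<alpha>, \<gamma>) = (1, k + 2)\<close> otherwise.
\<close>
definition index_A :: "bool \<times> nat \<times> nat \<Rightarrow> int" where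
  "index_A = (\<lambda>(e, k, j). (if e then 2 ^ (k + 1) else 1) * 3 ^ (j + 1))"

definition index_B :: "bool \<times> nat \<times> nat \<Rightarrow> int" where
  "index_B = (\<lambda>(e, k, j). if e then 1 else 2 ^ (k + 1))"

text \<open>This is the reduced inverse of \<open>index_A i\<close> modulo \<open>index_B i\<close>.
  For \<open>index_B i = 1\<close> it is 0, and then \<open>index_d i\<close> is -1.\<close>

definition index_c :: "bool \<times> nat \<times> nat \<Rightarrow> int" where
  "index_c i = (SOME c. 0 \<le> c \<and> c < index_B i \<and> index_B i dvd index_A i * c - 1)"

definition index_d :: "bool \<times> nat \<times> nat \<Rightarrow> int" where
  "index_d i = (index_A i * index_c i - 1) div index_B i"

lemma coprime_index: "coprime (index_A i) (index_B i)"
  by (auto simp: index_A_def index_B_def split: prod.split)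

lemma prime_triple_index: "prime_triple (index_A i) (index_B i) (index_c i) (index_d i)"
proof
  obtain e k j where i: "i = (e, k, j)" by (cases i)
  show pos: "0 < index_A i" "0 < index_B i" by (auto simp: i index_A_def index_B_def)
  obtain x where x: "[index_A i * x = 1] (mod index_B i)"
    using cong_solve_coprime_int[OF coprime_index] by blast
  have "[index_A i * (x mod index_B i) = index_A i * x] (mod index_B i)"
    by (intro cong_scalar_left) (simp add: cong_def)
  then have "index_B i dvd index_A i * (x mod index_B i) - 1"
    using x by (metis cong_iff_dvd_diff cong_trans)
  then have "\<exists>c. 0 \<le> c \<and> c < index_B i \<and> index_B i dvd index_A i * c - 1"
    using pos by (intro exI[of _ "x mod index_B i"]) auto
  from someI_ex[OF this] have c: "0 \<le> index_c i" "index_c i < index_B i"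
    "index_B i dvd index_A i * index_c i - 1" by (auto simp: index_c_def)
  then show "0 \<le> index_c i" "index_c i < index_B i" by auto
  show "index_A i * index_c i - index_B i * index_d i = 1"
    using c(3) by (simp add: index_d_def)
  fix l :: int assume l: "prime l"
  have "index_A i * index_B i = 2 ^ (k + 1) * 3 ^ (j + 1)"
    by (simp add: i index_A_def index_B_def)
  moreover have "l dvd 2 \<longleftrightarrow> l = 2" "l dvd 3 \<longleftrightarrow> l = 3"
    using primes_dvd_imp_eq[OF l, of 2] primes_dvd_imp_eq[OF l, of 3] by auto
  ultimately show "l dvd index_A i * index_B i \<longleftrightarrow> l = 2 \<or> l = 3"
    using l by (simp add: prime_dvd_mult_iff prime_dvd_power_iff del: power_Suc power_add)
qed

interpretation index: prime_triple "index_A i" "index_B i" "index_c i" "index_d i" for i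
  by (rule prime_triple_index)

lemma modulus_index: "index.modulus (e, k, j) = 12 * 2 ^ k * 3 ^ j"
  unfolding index.modulus_def by (simp add: index_A_def index_B_def)

text \<open>The defining forms give \<open>p + 1 = 2 * A * q\<close> and
  \<open>p - 1 = 2 * B * r\<close>, from which the exponents of 2 and 3 are read off.\<close>

lemma class_primes_indexD:
  assumes "p \<in> index.class_primes (e, k, j) X"
  obtains q r :: nat where "prime p" "real p + 1 \<le> X" "prime q" "q \<notin> {2, 3}" "prime r" "r \<notin> {2, 3}"
    "p + 1 = 2 ^ (if e then k + 2 else 1) * 3 ^ (j + 1) * q"
    "p - 1 = 2 ^ (if e then 1 else k + 2) * r"
proof -
  let ?i = "(e, k, j)"
  obtain n :: nat where p: "int p = 2 * index_A ?i * index_B ?i * int n + (2 * index_A ?i * index_c ?i - 1)"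
    "prime p" "real p + 1 \<le> X"
    and q: "prime (index_B ?i * int n + index_c ?i)" "index_B ?i * int n + index_c ?i \<notin> {2, 3}"
    and r: "prime (index_A ?i * int n + index_d ?i)" "index_A ?i * int n + index_d ?i \<notin> {2, 3}"
    using assms unfolding index.class_primes_def by blast
  define q' r' where "q' = nat (index_B ?i * int n + index_c ?i)" "r' = nat (index_A ?i * int n + index_d ?i)"
  have qr: "int q' = index_B ?i * int n + index_c ?i" "int r' = index_A ?i * int n + index_d ?i"
    using q(1) r(1) prime_ge_0_int unfolding q'_r'_def by auto
  have p1: "int p + 1 = 2 * index_A ?i * int q'"
    unfolding qr p(1) by (simp add: algebra_simps)
  have p2: "int p - 1 = 2 * index_B ?i * int r'"
    using index.bezout[of ?i] unfolding qr p(1) by (simp add: algebra_simps)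
  show thesis
  proof (rule that[OF p(2,3), of q' r'])
    show "prime q'" "prime r'" using q(1) r(1) unfolding qr[symmetric] by simp_all
    show "q' \<notin> {2, 3}" "r' \<notin> {2, 3}" using q(2) r(2) unfolding qr[symmetric] by auto
    have "int (p + 1) = int (2 ^ (if e then k + 2 else 1) * 3 ^ (j + 1) * q')"
      using p1 by (simp add: index_A_def algebra_simps)
    then show "p + 1 = 2 ^ (if e then k + 2 else 1) * 3 ^ (j + 1) * q'"
      by (simp only: of_nat_eq_iff)
    have "int (p - 1) = int (2 ^ (if e then 1 else k + 2) * r')"
      using p2 prime_ge_1_nat[OF p(2)] by (simp add: index_B_def algebra_simps)
    then show "p - 1 = 2 ^ (if e then 1 else k + 2) * r'"
      by (simp only: of_nat_eq_iff)
  qed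
qed

lemma coprime_6_prime_iff:
  fixes q :: nat
  assumes "prime q"
  shows "coprime 6 q \<longleftrightarrow> q \<noteq> 2 \<and> q \<noteq> 3"
proof -
  have "coprime (2 * 3) q \<longleftrightarrow> coprime 2 q \<and> coprime 3 q" by (simp only: coprime_mult_left_iff)
  moreover have "coprime 2 q \<longleftrightarrow> q \<noteq> 2" "coprime 3 q \<longleftrightarrow> q \<noteq> 3"
    using primes_coprime[OF two_is_prime_nat assms] primes_coprime[of 3 q] assms by auto
  ultimately show ?thesis by simp
qed

text \<open>These are members with \<open>\<mu> = \<nu> = 1\<close>; the congruence modulo 3 follows
  from \<open>3 dvd p + 1\<close>. The shift to \<open>X - 1\<close> reflects that the classes bound
  \<open>p + 1\<close>.\<close>

lemma class_primes_subset_A_bar: "index.class_primes i X \<subseteq> A_bar_upto (X - 1)"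
proof
  fix p assume p: "p \<in> index.class_primes i X"
  obtain e k j where i: "i = (e, k, j)" by (cases i)
  from p[unfolded i] obtain q r where qr: "prime p" "real p + 1 \<le> X" "prime q" "q \<notin> {2, 3}" "prime r" "r \<notin> {2, 3}"
    "p + 1 = 2 ^ (if e then k + 2 else 1) * 3 ^ (j + 1) * q"
    "p - 1 = 2 ^ (if e then 1 else k + 2) * r"
    by (rule class_primes_indexD)
  have "3 dvd p + 1" unfolding qr(7) by (intro dvd_mult2 dvd_mult dvd_power) simp_all
  then have mod3: "[p = 2] (mod 3)" unfolding cong_def by presburger
  have "coprime 6 q" "coprime 6 r" using qr(3-6) by (simp_all add: coprime_6_prime_iff)
  then have gcd6: "gcd 6 (q * r) = 1"
    by (simp only: coprime_mult_right_iff simp_thms flip: coprime_iff_gcd_eq_1)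
  have "p \<in> A_bar"
    unfolding A_bar_def
  proof (intro CollectI conjI exI)
    show "p + 1 = 2 ^ (if e then k + 2 else 1) * 3 ^ (j + 1) * q ^ 1"
      "p - 1 = 2 ^ (if e then 1 else k + 2) * r ^ 1"
      using qr(7,8) by (simp_all only: power_one_right)
    show "prime q" "prime r" by fact+
  qed (fact mod3 gcd6 qr(1) | simp)+
  then show "p \<in> A_bar_upto (X - 1)" using qr(2) by (simp add: A_bar_upto_def)
qed

lemma two_three_exponents_unique:
  fixes q q' :: nat
  assumes q: "prime q" "q \<notin> {2, 3}" and q': "prime q'" "q' \<notin> {2, 3}"
    and eq: "2 ^ a * 3 ^ b * q = 2 ^ a' * 3 ^ b' * q'"
  shows "a = a'" "b = b'"
proof -
  have nd: "\<not> 2 dvd 3 ^ b * q" "\<not> 3 dvd 2 ^ a * q" if "prime q" "q \<notin> {2, 3}" for q a b :: nat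
  proof -
    have "\<not> 2 dvd (3::nat) ^ b" by simp
    moreover have "\<not> 3 dvd (2::nat) ^ a"
      using prime_dvd_power[of 3 "2::nat" a] by auto
    moreover have "\<not> 2 dvd q" "\<not> 3 dvd q"
      using that primes_dvd_imp_eq[of 2 q] primes_dvd_imp_eq[of 3 q] by auto
    moreover have "prime (2::nat)" "prime (3::nat)" by simp_all
    ultimately show "\<not> 2 dvd 3 ^ b * q" "\<not> 3 dvd 2 ^ a * q"
      by (simp_all only: prime_dvd_mult_iff simp_thms)
  qed
  have "2 ^ a * (3 ^ b * q) = 2 ^ a' * (3 ^ b' * q')"
    using eq by (simp only: mult.assoc)
  then show "a = a'"
    by (rule prime_power_mult_cancel[OF two_is_prime_nat nd(1)[OF q] nd(1)[OF q']])
  have "prime (3::nat)" by simp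
  moreover have "3 ^ b * (2 ^ a * q) = 3 ^ b' * (2 ^ a' * q')"
    using eq by (metis mult.assoc mult.commute)
  ultimately show "b = b'"
    by (rule prime_power_mult_cancel[OF _ nd(2)[OF q] nd(2)[OF q']])
qed

text \<open>The exponents of 2 and 3 in \<open>p + 1\<close> and of 2 in \<open>p - 1\<close>
  determine \<open>e\<close>, \<open>k\<close> and \<open>j\<close>.\<close>

lemma class_primes_disjoint:
  assumes "p \<in> index.class_primes i X" "p \<in> index.class_primes i' X"
  shows "i = i'"
proof -
  obtain e k j e' k' j' where i: "i = (e, k, j)" "i' = (e', k', j')" by (metis prod.exhaust)
  from assms(1)[unfolded i] obtain q r where qr: "prime q" "q \<notin> {2, 3}" "prime r" "r \<notin> {2, 3}"
    "p + 1 = 2 ^ (if e then k + 2 else 1) * 3 ^ (j + 1) * q" "p - 1 = 2 ^ (if e then 1 else k + 2) * r"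
    by (rule class_primes_indexD)
  from assms(2)[unfolded i] obtain q' r' where qr': "prime q'" "q' \<notin> {2, 3}" "prime r'" "r' \<notin> {2, 3}"
    "p + 1 = 2 ^ (if e' then k' + 2 else 1) * 3 ^ (j' + 1) * q'" "p - 1 = 2 ^ (if e' then 1 else k' + 2) * r'"
    by (rule class_primes_indexD)
  have "(if e then k + 2 else 1) = (if e' then k' + 2 else 1)" "j + 1 = j' + 1"
    using two_three_exponents_unique[OF qr(1,2) qr'(1,2) trans[OF qr(5)[symmetric] qr'(5)]] .
  \<comment> \<open>The dummy factor \<open>3 ^ 0\<close> lets the uniqueness of exponents apply to
    \<open>p - 1\<close> as well.\<close>
  moreover have "2 ^ (if e then 1 else k + 2) * 3 ^ 0 * r = 2 ^ (if e' then 1 else k' + 2) * 3 ^ 0 * r'"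
    unfolding power_0 mult_1_right using qr(6) qr'(6) by (rule trans[OF sym])
  then have "(if e then 1 else k + 2) = (if e' then 1 else k' + 2)"
    by (rule two_three_exponents_unique(1)[OF qr(3,4) qr'(3,4)])
  ultimately show ?thesis unfolding i by (auto split: if_splits)
qed

lemma finite_A_bar_upto: "finite (A_bar_upto x)"
  by (rule finite_subset[of _ "{..nat \<lfloor>x\<rfloor>}"]) (auto simp: A_bar_upto_def le_nat_floor)

text \<open>Choosing a member of each nonempty \<open>K i\<close> is injective into the finite set
  \<open>S\<close>, so only finitely many terms of the infinite sum are nonzero.\<close>

lemma card_eq_infsum_disjoint:
  fixes K :: "'i \<Rightarrow> 'a set"
  assumes S: "finite S" and K: "\<And>i. K i \<subseteq> S"
    and unique: "\<And>p i i'. p \<in> K i \<Longrightarrow> p \<in> K i' \<Longrightarrow> i = i'"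
  shows "real (card S) = (\<Sum>\<^sub>\<infinity>i. real (card (K i))) + real (card (S - (\<Union>i. K i)))"
proof -
  define J where "J = {i. K i \<noteq> {}}"
  define f where "f i = (SOME p. p \<in> K i)" for i
  have f: "f i \<in> K i" if "i \<in> J" for i
    using that by (auto simp: J_def f_def some_in_eq)
  have "finite J"
  proof (rule inj_on_finite[OF _ _ S])
    show "inj_on f J" using f unique by (metis inj_onI)
    show "f ` J \<subseteq> S" using f K by blast
  qed
  have fin: "finite (K i)" for i using S K by (rule rev_finite_subset)
  have U: "(\<Union>i. K i) = (\<Union>i\<in>J. K i)" by (auto simp: J_def)
  have "card (\<Union>i\<in>J. K i) = (\<Sum>i\<in>J. card (K i))"
    using fin unique by (intro card_UN_disjoint \<open>finite J\<close>) blast+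
  moreover have "((\<lambda>i. real (card (K i))) has_sum (\<Sum>i\<in>J. real (card (K i)))) UNIV"
    by (rule has_sum_finite_neutralI[OF \<open>finite J\<close>]) (auto simp: J_def)
  ultimately have "(\<Sum>\<^sub>\<infinity>i. real (card (K i))) = real (card (\<Union>i. K i))"
    unfolding U by (simp add: infsumI)
  moreover have "(\<Union>i. K i) \<subseteq> S" using K by blast
  then have "card S = card (\<Union>i. K i) + card (S - (\<Union>i. K i))"
    using S by (metis card_Diff_subset card_mono finite_subset le_add_diff_inverse)
  ultimately show ?thesis by simp
qed

lemma card_A_bar_upto_split:
  "real (card (A_bar_upto (X - 1))) = (\<Sum>\<^sub>\<infinity>i. real (card (index.class_primes i X)))
     + real (card (A_bar_upto (X - 1) - (\<Union>i. index.class_primes i X)))"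
  by (rule card_eq_infsum_disjoint[OF finite_A_bar_upto class_primes_subset_A_bar])
    (rule class_primes_disjoint)

section \<open>The exceptional primes and the theorem\<close>

text \<open>Subtracting the Bezout identity from \<open>A*q - B*r = 1\<close> gives
  \<open>q = B*m + c\<close> and \<open>r = A*m + d\<close>. A negative \<open>m\<close> would make
  \<open>q\<close> negative because \<open>c < B\<close>, and \<open>m = 0\<close> leaves the single
  candidate \<open>2*A*c - 1\<close>.\<close>

lemma class_primes_or_initial:
  fixes q r :: nat
  assumes p: "prime p" "real p + 1 \<le> X" and q: "prime q" "q \<notin> {2, 3}" and r: "prime r" "r \<notin> {2, 3}"
    and eqs: "p + 1 = 2 ^ (if e then k + 2 else 1) * 3 ^ (j + 1) * q"
      "p - 1 = 2 ^ (if e then 1 else k + 2) * r"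
  shows "p \<in> index.class_primes (e, k, j) X \<or> p = nat (2 * index_A (e, k, j) * index_c (e, k, j) - 1)"
proof -
  define A B c d where "A = index_A (e, k, j)" "B = index_B (e, k, j)" "c = index_c (e, k, j)" "d = index_d (e, k, j)"
  note defs = this
  interpret i: prime_triple A B c d unfolding defs by (rule prime_triple_index)
  have "int (p + 1) = int (2 ^ (if e then k + 2 else 1) * 3 ^ (j + 1) * q)"
    by (simp only: eqs(1))
  then have p1: "int p + 1 = 2 * (A * int q)" by (simp add: defs index_A_def algebra_simps)
  have "int (p - 1) = int (2 ^ (if e then 1 else k + 2) * r)"
    by (simp only: eqs(2))
  then have p2: "int p - 1 = 2 * (B * int r)"
    using prime_ge_1_nat[OF p(1)] by (simp add: defs index_B_def of_nat_diff algebra_simps)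
  have "A * int q - B * int r = 1" using p1 p2 by linarith
  then have diff: "A * (int q - c) = B * (int r - d)" using i.bezout by (simp add: algebra_simps)
  then have "B dvd A * (int q - c)" by simp
  moreover have "coprime B A" unfolding defs using coprime_index coprime_commute by blast
  ultimately have "B dvd int q - c" by (simp add: coprime_dvd_mult_right_iff)
  then obtain m where m: "int q - c = B * m" by blast
  have "B * (A * m) = B * (int r - d)" using diff unfolding m by (simp add: mult.left_commute)
  then have m': "int r - d = A * m" using i.B_pos by simp
  have "0 \<le> m"
  proof (rule ccontr)
    assume "\<not> 0 \<le> m"
    then have "B * m \<le> B * (-1)" using i.B_pos by (intro mult_left_mono) auto
    then show False using m i.c_less by linarith
  qed
  then obtain n where n: "m = int n" using nonneg_int_cases by blast
  have qn: "int q = B * int n + c" and rn: "int r = A * int n + d"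
    using m m' unfolding n by linarith+
  have pn: "int p = 2 * A * B * int n + (2 * A * c - 1)"
    using p1 unfolding qn by (simp add: algebra_simps)
  show ?thesis
  proof (cases "n = 0")
    case True
    then have "p = nat (2 * A * c - 1)" using pn by simp
    then show ?thesis unfolding defs by blast
  next
    case False
    have "prime (B * int n + c)" "prime (A * int n + d)"
      using q(1) r(1) unfolding qn[symmetric] rn[symmetric] by simp_all
    moreover have "B * int n + c \<notin> {2, 3}" "A * int n + d \<notin> {2, 3}"
      using q(2) r(2) unfolding qn[symmetric] rn[symmetric] by auto
    ultimately have "p \<in> i.class_primes X"
      unfolding i.class_primes_def using False pn p by (intro CollectI exI[of _ n]) simp
    then show ?thesis unfolding defs by blast
  qed
qed

text \<open>After halving, \<open>p + 1\<close> and \<open>p - 1\<close> become consecutive integers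
  with odd cofactors \<open>3 ^ \<beta> * q\<close> and \<open>r\<close>, so exactly one of the
  reduced exponents is 0.\<close>

lemma A_bar_exponents_cases:
  fixes q r :: nat
  assumes q: "prime q" "q \<noteq> 2" and r: "prime r" "r \<noteq> 2"
    and "1 \<le> \<alpha>" "1 \<le> \<gamma>" and eqs: "p + 1 = 2 ^ \<alpha> * 3 ^ \<beta> * q" "p - 1 = 2 ^ \<gamma> * r"
  obtains e k where "\<alpha> = (if e then k + 2 else 1)" "\<gamma> = (if e then 1 else k + 2)"
proof -
  obtain a g where ag: "\<alpha> = Suc a" "\<gamma> = Suc g"
    using assms(5,6) by (metis Suc_le_D One_nat_def)
  have odd: "odd q" "odd r"
    using q r primes_dvd_imp_eq[OF two_is_prime_nat] by auto
  have "0 < 2 ^ \<gamma> * r" using r prime_gt_0_nat by simp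
  then have "2 ^ \<alpha> * 3 ^ \<beta> * q = 2 ^ \<gamma> * r + 2" using eqs by linarith
  then have "2 ^ a * (3 ^ \<beta> * q) = 2 ^ g * r + 1" unfolding ag by simp
  moreover have "even (2 ^ a * (3 ^ \<beta> * q)) \<longleftrightarrow> a \<noteq> 0" "even (2 ^ g * r) \<longleftrightarrow> g \<noteq> 0"
    using odd by auto
  ultimately have "a \<noteq> 0 \<longleftrightarrow> g = 0" by auto
  then show thesis
    using that[of True "a - 1"] that[of False "g - 1"] ag by (cases "g = 0") auto
qed

text \<open>The three sets cover \<open>\<mu> >= 2\<close>, \<open>\<nu> >= 2\<close>, and the value
  \<open>n = 0\<close> of the remaining classes. Every exponent is at most \<open>log 2 X\<close>
  because its power divides \<open>p + 1\<close> or \<open>p - 1\<close>; a base raised to an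
  exponent of at least 2 is at most \<open>sqrt X\<close>.\<close>

lemma exceptional_subset:
  assumes L: "L = nat \<lfloor>log 2 X\<rfloor>" and Q: "Q = nat \<lfloor>sqrt X\<rfloor>"
  shows "A_bar_upto (X - 1) - (\<Union>i. index.class_primes i X)
    \<subseteq> (\<lambda>(a, b, m, q). 2 ^ a * 3 ^ b * q ^ m - 1) ` ({..L} \<times> {..L} \<times> {..L} \<times> {..Q})
     \<union> (\<lambda>(g, m, r). 2 ^ g * r ^ m + 1) ` ({..L} \<times> {..L} \<times> {..Q})
     \<union> (\<lambda>i. nat (2 * index_A i * index_c i - 1)) ` (UNIV \<times> {..L} \<times> {..L})" (is "_ \<subseteq> ?E1 \<union> ?E2 \<union> ?E3")
proof
  fix p assume p: "p \<in> A_bar_upto (X - 1) - (\<Union>i. index.class_primes i X)"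
  then have pX: "real p + 1 \<le> X" and "p \<in> A_bar"
    unfolding A_bar_upto_def by auto
  have notin: "p \<notin> index.class_primes i X" for i using p by blast
  from \<open>p \<in> A_bar\<close> have "prime p" and ex: "\<exists>\<alpha> \<beta> \<gamma> \<mu> \<nu> q r :: nat.
        1 \<le> \<alpha> \<and> 1 \<le> \<beta> \<and> 1 \<le> \<gamma> \<and> 1 \<le> \<mu> \<and> 1 \<le> \<nu> \<and>
        prime q \<and> prime r \<and> gcd 6 (q * r) = 1 \<and>
        p + 1 = 2 ^ \<alpha> * 3 ^ \<beta> * q ^ \<mu> \<and> p - 1 = 2 ^ \<gamma> * r ^ \<nu>"
    unfolding A_bar_def mem_Collect_eq by - (elim conjE, assumption)+
  obtain \<alpha> \<beta> \<gamma> \<mu> \<nu> q r :: nat where H: "1 \<le> \<alpha> \<and> 1 \<le> \<beta> \<and> 1 \<le> \<gamma> \<and> 1 \<le> \<mu> \<and> 1 \<le> \<nu> \<and>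
        prime q \<and> prime r \<and> gcd 6 (q * r) = 1 \<and>
        p + 1 = 2 ^ \<alpha> * 3 ^ \<beta> * q ^ \<mu> \<and> p - 1 = 2 ^ \<gamma> * r ^ \<nu>"
    using ex by (elim exE) (rule that)
  then have ge1: "1 \<le> \<alpha>" "1 \<le> \<beta>" "1 \<le> \<gamma>" "1 \<le> \<mu>" "1 \<le> \<nu>"
    and pqr: "prime p" "prime q" "prime r" and g: "gcd 6 (q * r) = 1"
    and eqs: "p + 1 = 2 ^ \<alpha> * 3 ^ \<beta> * q ^ \<mu>" "p - 1 = 2 ^ \<gamma> * r ^ \<nu>"
    using \<open>prime p\<close> by - (elim conjE, assumption)+
  have "coprime 6 q" "coprime 6 r"
    using g by (simp_all only: coprime_mult_right_iff flip: coprime_iff_gcd_eq_1)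
  then have qr23: "q \<noteq> 2" "q \<noteq> 3" "r \<noteq> 2" "r \<noteq> 3"
    using pqr by (simp_all add: coprime_6_prime_iff)
  have L_bound: "a \<le> L" if "b ^ a \<le> p + 1" "2 \<le> b" for a b :: nat
  proof -
    have "2 ^ a \<le> b ^ a" using that(2) by (rule power_mono) simp
    then have "real (2 ^ a) \<le> real (p + 1)" using that(1) by (simp only: of_nat_le_iff)
    then have "2 ^ a \<le> X" using pX by simp
    then have "real a \<le> log 2 X" by (rule le_log_of_power) simp
    then show ?thesis unfolding L by (rule le_nat_floor)
  qed
  have Q_bound: "b \<le> Q" if "b ^ m \<le> p + 1" "2 \<le> m" "1 \<le> b" for b m :: nat
  proof -
    have "b ^ 2 \<le> b ^ m" using that(2,3) by (rule power_increasing)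
    then have "real (b ^ 2) \<le> real (p + 1)" using that(1) by (simp only: of_nat_le_iff)
    then have "real b \<le> sqrt X" using pX by (intro real_le_rsqrt) simp
    then show ?thesis unfolding Q by (rule le_nat_floor)
  qed
  have "q ^ \<mu> dvd p + 1" "2 ^ \<alpha> dvd p + 1" "3 ^ \<beta> dvd p + 1"
    unfolding eqs(1) by simp_all
  then have "q ^ \<mu> \<le> p + 1" "2 ^ \<alpha> \<le> p + 1" "3 ^ \<beta> \<le> p + 1"
    by (auto dest: dvd_imp_le)
  have p_gt_1: "0 < p - 1" using prime_ge_2_nat[OF pqr(1)] by simp
  moreover have "r ^ \<nu> dvd p - 1" "2 ^ \<gamma> dvd p - 1"
    unfolding eqs(2) by simp_all
  ultimately have "r ^ \<nu> \<le> p - 1" "2 ^ \<gamma> \<le> p - 1"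
    by (simp_all only: dvd_imp_le)
  then have "r ^ \<nu> \<le> p + 1" "2 ^ \<gamma> \<le> p + 1" by linarith+
  note le = this \<open>q ^ \<mu> \<le> p + 1\<close> \<open>2 ^ \<alpha> \<le> p + 1\<close> \<open>3 ^ \<beta> \<le> p + 1\<close>
  have L_le: "\<alpha> \<le> L" "\<beta> \<le> L" "\<gamma> \<le> L" "\<mu> \<le> L" "\<nu> \<le> L"
    using L_bound[OF le(4)] L_bound[OF le(5)] L_bound[OF le(2)] L_bound[OF le(3)] L_bound[OF le(1)]
      prime_ge_2_nat[OF pqr(2)] prime_ge_2_nat[OF pqr(3)] by simp_all
  consider "2 \<le> \<mu>" | "2 \<le> \<nu>" | "\<mu> = 1" "\<nu> = 1" using ge1(4,5) by linarith
  then show "p \<in> ?E1 \<union> ?E2 \<union> ?E3"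
  proof cases
    case 1
    have "p = 2 ^ \<alpha> * 3 ^ \<beta> * q ^ \<mu> - 1" using eqs(1) by simp
    then have "p \<in> ?E1"
      using L_le Q_bound[OF le(3) 1] prime_ge_1_nat[OF pqr(2)]
      by (intro image_eqI[of _ _ "(\<alpha>, \<beta>, \<mu>, q)"]) simp_all
    then show ?thesis by blast
  next
    case 2
    have "p = 2 ^ \<gamma> * r ^ \<nu> + 1" using eqs(2) p_gt_1 by linarith
    then have "p \<in> ?E2"
      using L_le Q_bound[OF le(1) 2] prime_ge_1_nat[OF pqr(3)]
      by (intro image_eqI[of _ _ "(\<gamma>, \<nu>, r)"]) simp_all
    then show ?thesis by blast
  next
    case 3
    have qr23': "q \<notin> {2, 3}" "r \<notin> {2, 3}" using qr23 by simp_all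
    have eqs': "p + 1 = 2 ^ \<alpha> * 3 ^ \<beta> * q" "p - 1 = 2 ^ \<gamma> * r" using eqs 3 by simp_all
    obtain e k where ek: "\<alpha> = (if e then k + 2 else 1)" "\<gamma> = (if e then 1 else k + 2)"
      by (rule A_bar_exponents_cases[OF pqr(2) qr23(1) pqr(3) qr23(3) ge1(1,3) eqs'])
    obtain j where j: "\<beta> = j + 1" using ge1(2) by (intro that[of "\<beta> - 1"]) simp
    have "p = nat (2 * index_A (e, k, j) * index_c (e, k, j) - 1)"
      using class_primes_or_initial[OF pqr(1) pX pqr(2) qr23'(1) pqr(3) qr23'(2) eqs'[unfolded ek j]]
        notin[of "(e, k, j)"] by argo
    moreover have "k \<le> L" "j \<le> L" using L_le(1-3) unfolding ek j by (auto split: if_splits)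
    ultimately have "p \<in> ?E3" by (intro image_eqI[of _ _ "(e, k, j)"]) simp_all
    then show ?thesis by blast
  qed
qed

text \<open>The parameter boxes have \<open>l^3 * s\<close>, \<open>l^2 * s\<close> and
  \<open>2 * l^2\<close> elements, the last 2 coming from the flag \<open>e\<close>; together they
  are at most \<open>4 * l^3 * s\<close>.\<close>

lemma card_exceptional_le:
  assumes X: "1 \<le> X"
  shows "real (card (A_bar_upto (X - 1) - (\<Union>i. index.class_primes i X)))
     \<le> 4 * (log 2 X + 1) ^ 3 * (sqrt X + 1)"
proof -
  define L Q where "L = nat \<lfloor>log 2 X\<rfloor>" "Q = nat \<lfloor>sqrt X\<rfloor>"
  define l s where "l = L + 1" "s = Q + 1"
  let ?E1 = "(\<lambda>(a, b, m, q). 2 ^ a * 3 ^ b * q ^ m - 1) ` ({..L} \<times> {..L} \<times> {..L} \<times> {..Q}) :: nat set"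
  let ?E2 = "(\<lambda>(g, m, r). 2 ^ g * r ^ m + 1) ` ({..L} \<times> {..L} \<times> {..Q}) :: nat set"
  let ?E3 = "(\<lambda>i. nat (2 * index_A i * index_c i - 1)) ` (UNIV \<times> {..L} \<times> {..L})"
  have fin: "finite (?E1 \<union> ?E2 \<union> ?E3)" by auto
  have "card (A_bar_upto (X - 1) - (\<Union>i. index.class_primes i X)) \<le> card (?E1 \<union> ?E2 \<union> ?E3)"
    by (rule card_mono[OF fin exceptional_subset[OF L_Q_def]])
  also have "\<dots> \<le> card ?E1 + card ?E2 + card ?E3"
    by (intro order_trans[OF card_Un_le] add_mono card_Un_le order_refl)
  also have "\<dots> \<le> card ({..L} \<times> {..L} \<times> {..L} \<times> {..Q}) + card ({..L} \<times> {..L} \<times> {..Q})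
      + card ((UNIV :: bool set) \<times> {..L} \<times> {..L})"
    by (intro add_mono card_image_le) auto
  also have "\<dots> = l ^ 3 * s + l ^ 2 * s + 2 * l ^ 2"
  proof -
    have "card {..L} = l" "card {..Q} = s" "card (UNIV :: bool set) = 2" by (simp_all add: l_s_def)
    then show ?thesis
      by (simp only: card_cartesian_product power3_eq_cube power2_eq_square mult.assoc)
  qed
  also have "\<dots> \<le> 4 * (l ^ 3 * s)"
  proof -
    have "l ^ 2 \<le> l ^ 3" by (rule power_increasing) (auto simp: l_s_def)
    moreover from this have "l ^ 2 * s \<le> l ^ 3 * s" by simp
    moreover have "l ^ 3 \<le> l ^ 3 * s" by (simp add: l_s_def)
    ultimately show ?thesis by linarith
  qed
  finally have "real (card (A_bar_upto (X - 1) - (\<Union>i. index.class_primes i X))) \<le> real (4 * (l ^ 3 * s))"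
    by (simp only: of_nat_le_iff)
  also have "\<dots> = 4 * real l ^ 3 * real s" by simp
  also have "\<dots> \<le> 4 * (log 2 X + 1) ^ 3 * (sqrt X + 1)"
    using X by (intro mult_mono power_mono) (auto simp: l_s_def L_Q_def intro!: zero_le_log_cancel_iff[THEN iffD2] add_nonneg_nonneg)
  finally show ?thesis .
qed

theorem theorem2p1:
  assumes "generalized_Hardy_Littlewood"
  shows "(\<lambda>x::real. real (card (A_bar_upto x)))
           \<sim>[at_top] (\<lambda>x. singular_series_A / 2 * (x / ln x ^ 3))"
proof -
  define f where "f i X = real (card (index.class_primes i X)) * ln X ^ 3 / X" for i X
  obtain M where M: "eventually (\<lambda>X. \<forall>A B c d. prime_triple A B c d \<longrightarrow>
    real (card (prime_triple.class_primes A B c d X)) * ln X ^ 3 / X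
      \<le> M / sqrt (prime_triple.modulus A B)) at_top"
    using class_primes_dominated[OF assms] .
  have shift: "filterlim (\<lambda>x::real. x + 1) at_top at_top" by real_asymp
  have main: "((\<lambda>X. \<Sum>\<^sub>\<infinity>i. f i X) \<longlongrightarrow> singular_series_A / 2) at_top"
  proof (rule tannery_infsum)
    show "(f i \<longlongrightarrow> singular_series_A / index.modulus i) at_top" for i
      unfolding f_def by (rule index.class_primes_tendsto[OF assms])
    show "\<forall>\<^sub>F X in at_top. \<forall>i. \<bar>f i X\<bar> \<le> M / sqrt (index.modulus i)"
      using M eventually_gt_at_top[of 1]
      by eventually_elim (use prime_triple_index in \<open>auto simp: f_def\<close>)
    \<comment> \<open>The sum is \<open>2 / ((1/2) * (2/3)) = 6\<close>. Since the modulus is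
      \<open>12 * 2^k * 3^j\<close>, the reciprocals of the moduli add up to
      \<open>6 / 12 = 1/2\<close>.\<close>
    have "((\<lambda>(e::bool, k, j). (1 / 2) ^ k * (1 / 3) ^ j) has_sum (6::real)) (UNIV :: (bool \<times> nat \<times> nat) set)"
      using has_sum_geometric_index[of "1/2" "1/3"] by simp
    from has_sum_cmult_right[OF this, of "singular_series_A / 12"]
    have "((\<lambda>i. singular_series_A / index.modulus i) has_sum (singular_series_A / 12 * 6)) UNIV"
      by (rule has_sum_cong[THEN iffD1, rotated]) (auto simp: modulus_index power_divide)
    then show "((\<lambda>i. singular_series_A / index.modulus i) has_sum singular_series_A / 2) UNIV"
      by simp
    \<comment> \<open>The majorant is still geometric after taking square roots of the moduli, with
      ratios below 1.\<close>
    have "((\<lambda>(e::bool, k, j). (1 / sqrt 2) ^ k * (1 / sqrt 3) ^ j) summable_on (UNIV :: (bool \<times> nat \<times> nat) set))"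
      using has_sum_geometric_index[of "1 / sqrt 2" "1 / sqrt 3"] by (auto intro: has_sum_imp_summable)
    from summable_on_cmult_right[OF this, of "M / sqrt 12"]
    show "(\<lambda>i. M / sqrt (index.modulus i)) summable_on UNIV"
      by (rule summable_on_cong[THEN iffD1, rotated])
         (auto simp: modulus_index power_divide real_sqrt_mult real_sqrt_power)
  qed
  \<comment> \<open>The normalised exceptional count is of order
    \<open>ln X ^ 6 / sqrt X\<close>.\<close>
  have "((\<lambda>X. 4 * (log 2 X + 1) ^ 3 * (sqrt X + 1) * (ln X ^ 3 / X)) \<longlongrightarrow> 0) at_top"
    by real_asymp
  then have "((\<lambda>X. real (card (A_bar_upto (X - 1) - (\<Union>i. index.class_primes i X))) * (ln X ^ 3 / X)) \<longlongrightarrow> 0) at_top"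
  proof (rule Lim_null_comparison[rotated])
    show "\<forall>\<^sub>F X in at_top. norm (real (card (A_bar_upto (X - 1) - (\<Union>i. index.class_primes i X))) * (ln X ^ 3 / X))
       \<le> 4 * (log 2 X + 1) ^ 3 * (sqrt X + 1) * (ln X ^ 3 / X)"
      using eventually_ge_at_top[of 1]
    proof eventually_elim
      case (elim X)
      then have nonneg: "0 \<le> ln X ^ 3 / X" by simp
      show ?case
        using mult_right_mono[OF card_exceptional_le[OF elim] nonneg]
        by (simp only: abs_mult real_norm_def abs_of_nonneg[OF nonneg] abs_of_nat)
    qed
  qed
  from tendsto_add[OF main this]
  have "((\<lambda>X. real (card (A_bar_upto (X - 1))) * (ln X ^ 3 / X)) \<longlongrightarrow> singular_series_A / 2) at_top"
    by (simp only: card_A_bar_upto_split f_def distrib_right times_divide_eq_right[symmetric]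
      infsum_cmult_left' add_0_right)
  \<comment> \<open>Putting \<open>X = x + 1\<close> turns the bound on \<open>p + 1\<close> into
    \<open>p <= x\<close>; the change of normalisation is a factor tending to 1.\<close>
  from filterlim_compose[OF this shift]
  have "((\<lambda>x. real (card (A_bar_upto x)) * (ln (x + 1) ^ 3 / (x + 1))) \<longlongrightarrow> singular_series_A / 2) at_top"
    by simp
  moreover have "((\<lambda>x::real. ((x + 1) / ln (x + 1) ^ 3) / (x / ln x ^ 3)) \<longlongrightarrow> 1) at_top"
    by real_asymp
  ultimately have "((\<lambda>x. real (card (A_bar_upto x)) * (ln (x + 1) ^ 3 / (x + 1))
      * (((x + 1) / ln (x + 1) ^ 3) / (x / ln x ^ 3)) / (singular_series_A / 2))
      \<longlongrightarrow> singular_series_A / 2 * 1 / (singular_series_A / 2)) at_top"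
    using singular_series_A_nonzero by (intro tendsto_divide tendsto_mult tendsto_const) auto
  then have "((\<lambda>x. real (card (A_bar_upto x)) * (ln (x + 1) ^ 3 / (x + 1))
      * (((x + 1) / ln (x + 1) ^ 3) / (x / ln x ^ 3)) / (singular_series_A / 2)) \<longlongrightarrow> 1) at_top"
    using singular_series_A_nonzero by simp
  then have "((\<lambda>x. real (card (A_bar_upto x)) / (singular_series_A / 2 * (x / ln x ^ 3))) \<longlongrightarrow> 1) at_top"
  proof (rule Lim_transform_eventually)
    have cancel: "K * (L / Y) * ((Y / L) / Z) / S = K / (S * Z)" if "L \<noteq> 0" "Y \<noteq> 0" for K L S Y Z :: real
      using that by simp
    show "\<forall>\<^sub>F x in at_top. real (card (A_bar_upto x)) * (ln (x + 1) ^ 3 / (x + 1))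
      * (((x + 1) / ln (x + 1) ^ 3) / (x / ln x ^ 3)) / (singular_series_A / 2)
       = real (card (A_bar_upto x)) / (singular_series_A / 2 * (x / ln x ^ 3))"
      using eventually_gt_at_top[of 1] by eventually_elim (rule cancel, auto)
  qed
  then show ?thesis by (rule asymp_equivI')
qed

end
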